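(* Let $\mathbb F$ be a field of characteristic $2$, let $n\ge 1$, and let $\lambda\vdash n$ be a partition that is not a hook. Then the Specht module $\operatorname{Sp}^\lambda$ of the symmetric group $\mathfrak S_n$ over $\mathbb F$ has no one-dimensional direct summand as an $\mathbb F\mathfrak S_n$-module.
   Context: A partition $\lambda\vdash n$ is a hook if $\lambda=(n-r,1^r)$ for some $0\le r\le n-1$; one-row and one-column partitions are hooks. For $\lambda\vdash n$, let $M^\lambda$ be the permutation $\mathbb F\mathfrak S_n$-module with basis the set of $\lambda$-tabloids (row-equivalence classes $\{t\}$ of bijective fillings $t$ of the Young diagram of $\lambda$ with $1,\dots,n$). The Specht module $\operatorname{Sp}^\lambda$ (James's convention) is the submodule of $M^\lambda$ spanned by the polytabloids $e_t=\sum_{\pi\in C_t}\operatorname{sgn}(\pi)\,\{\pi t\}$, where $C_t\le\mathfrak S_n$ is the column stabilizer of $t$. In characteristic $2$ the trivial module is the unique one-dimensional $\mathbb F\mathfrak S_n$-module up to isomorphism. *)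

theory Defs
  imports
    "HOL-Library.Poly_Mapping"
    "HOL-Combinatorics.Permutations"
    "HOL-Computational_Algebra.Computational_Algebra"
begin

definition is_partition :: "nat \<Rightarrow> nat list \<Rightarrow> bool" where
  "is_partition n \<mu> \<longleftrightarrow> sorted_wrt (\<ge>) \<mu> \<and> 0 \<notin> set \<mu> \<and> sum_list \<mu> = n"

definition is_hook :: "nat \<Rightarrow> nat list \<Rightarrow> bool" where
  "is_hook n \<mu> \<longleftrightarrow> (\<exists>r\<le>n - 1. \<mu> = (n - r) # replicate r 1)"

text \<open>Boxes are pairs (row, column), both counted from 0.\<close>

definition diagram :: "nat list \<Rightarrow> (nat \<times> nat) set" where
  "diagram \<mu> = {(i, j). i < length \<mu> \<and> j < \<mu> ! i}"

text \<open>
  A tableau is extended by 0 outside its diagram. Permutations of \<open>{1..n}\<close> fix 0, so the action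
  of \<open>\<pi>\<close> on the entries of \<open>t\<close> is just \<open>\<pi> \<circ> t\<close>.
\<close>

type_synonym tableau = "nat \<times> nat \<Rightarrow> nat"

definition tableaux :: "nat \<Rightarrow> nat list \<Rightarrow> tableau set" where
  "tableaux n \<mu> = {t. bij_betw t (diagram \<mu>) {1..n} \<and> (\<forall>x. x \<notin> diagram \<mu> \<longrightarrow> t x = 0)}"

definition row_stabilizer :: "nat \<Rightarrow> nat list \<Rightarrow> tableau \<Rightarrow> (nat \<Rightarrow> nat) set" where
  "row_stabilizer n \<mu> t = {\<pi>. \<pi> permutes {1..n} \<and>
     (\<forall>x\<in>diagram \<mu>. \<exists>y\<in>diagram \<mu>. fst y = fst x \<and> \<pi> (t x) = t y)}"

definition column_stabilizer :: "nat \<Rightarrow> nat list \<Rightarrow> tableau \<Rightarrow> (nat \<Rightarrow> nat) set" where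
  "column_stabilizer n \<mu> t = {\<pi>. \<pi> permutes {1..n} \<and>
     (\<forall>x\<in>diagram \<mu>. \<exists>y\<in>diagram \<mu>. snd y = snd x \<and> \<pi> (t x) = t y)}"

type_synonym tabloid = "tableau set"

definition tabloid_of :: "nat \<Rightarrow> nat list \<Rightarrow> tableau \<Rightarrow> tabloid" where
  "tabloid_of n \<mu> t = (\<lambda>\<pi>. \<pi> \<circ> t) ` row_stabilizer n \<mu> t"

text \<open>
  The permutation modules for all shapes live inside one vector space, that of finitely supported
  functions on \<^typ>\<open>tabloid\<close>; a tabloid \<open>T\<close> is identified with \<open>single T 1\<close>.
\<close>

definition scale :: "'a::field \<Rightarrow> (tabloid \<Rightarrow>\<^sub>0 'a) \<Rightarrow> (tabloid \<Rightarrow>\<^sub>0 'a)" where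
  "scale c v = Poly_Mapping.map ((*) c) v"

lemma lookup_scale: "Poly_Mapping.lookup (scale c v) T = c * Poly_Mapping.lookup v T"
  by (simp add: scale_def Poly_Mapping.map.rep_eq when_def)

global_interpretation tabloid_space: vector_space "scale :: 'a::field \<Rightarrow> _"
  by unfold_locales
    (rule poly_mapping_eqI; simp add: lookup_scale lookup_add algebra_simps)+

definition perm_module :: "nat \<Rightarrow> nat list \<Rightarrow> (tabloid \<Rightarrow>\<^sub>0 'a::field) set" where
  "perm_module n \<mu> = tabloid_space.span ((\<lambda>t. Poly_Mapping.single (tabloid_of n \<mu> t) 1) ` tableaux n \<mu>)"

definition act :: "(nat \<Rightarrow> nat) \<Rightarrow> (tabloid \<Rightarrow>\<^sub>0 'a::field) \<Rightarrow> (tabloid \<Rightarrow>\<^sub>0 'a)" where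
  "act \<pi> v = (\<Sum>T\<in>Poly_Mapping.keys v. Poly_Mapping.single ((\<lambda>t. \<pi> \<circ> t) ` T) (Poly_Mapping.lookup v T))"

definition polytabloid :: "nat \<Rightarrow> nat list \<Rightarrow> tableau \<Rightarrow> (tabloid \<Rightarrow>\<^sub>0 'a::field)" where
  "polytabloid n \<mu> t =
     (\<Sum>\<pi>\<in>column_stabilizer n \<mu> t. Poly_Mapping.single (tabloid_of n \<mu> (\<pi> \<circ> t)) (of_int (sign \<pi>)))"

definition Specht :: "nat \<Rightarrow> nat list \<Rightarrow> (tabloid \<Rightarrow>\<^sub>0 'a::field) set" where
  "Specht n \<mu> = tabloid_space.span (polytabloid n \<mu> ` tableaux n \<mu>)"

lemma Specht_subset_perm_module: "Specht n \<mu> \<subseteq> (perm_module n \<mu> :: (tabloid \<Rightarrow>\<^sub>0 'a::field) set)"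
  unfolding Specht_def
proof (rule tabloid_space.span_minimal)
  show "tabloid_space.subspace (perm_module n \<mu> :: (tabloid \<Rightarrow>\<^sub>0 'a) set)"
    unfolding perm_module_def by (rule tabloid_space.subspace_span)
  show "polytabloid n \<mu> ` tableaux n \<mu> \<subseteq> (perm_module n \<mu> :: (tabloid \<Rightarrow>\<^sub>0 'a) set)"
  proof
    fix v :: "tabloid \<Rightarrow>\<^sub>0 'a"
    assume "v \<in> polytabloid n \<mu> ` tableaux n \<mu>"
    then obtain t where t: "t \<in> tableaux n \<mu>" and v: "v = polytabloid n \<mu> t" by blast
    have "Poly_Mapping.single (tabloid_of n \<mu> (\<pi> \<circ> t)) (of_int (sign \<pi>)) \<in> (perm_module n \<mu> :: (tabloid \<Rightarrow>\<^sub>0 'a) set)"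
      if "\<pi> \<in> column_stabilizer n \<mu> t" for \<pi>
    proof -
      have p: "\<pi> permutes {1..n}" using that by (simp add: column_stabilizer_def)
      have "\<pi> \<circ> t \<in> tableaux n \<mu>"
        using t bij_betw_trans[OF _ permutes_imp_bij[OF p]] permutes_not_in[OF p, of 0]
        by (auto simp: tableaux_def)
      then have "scale (of_int (sign \<pi>)) (Poly_Mapping.single (tabloid_of n \<mu> (\<pi> \<circ> t)) 1)
          \<in> (perm_module n \<mu> :: (tabloid \<Rightarrow>\<^sub>0 'a) set)"
        unfolding perm_module_def
        by (intro tabloid_space.span_scale tabloid_space.span_base) blast
      moreover have "scale c (Poly_Mapping.single T 1) = Poly_Mapping.single T c" for c :: 'a and T
        by (rule poly_mapping_eqI) (simp add: lookup_scale lookup_single when_def)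
      ultimately show ?thesis by simp
    qed
    then show "v \<in> perm_module n \<mu>"
      unfolding v polytabloid_def perm_module_def by (rule tabloid_space.span_sum)
  qed
qed

definition is_submodule :: "nat \<Rightarrow> (tabloid \<Rightarrow>\<^sub>0 'a::field) set \<Rightarrow> bool" where
  "is_submodule n U \<longleftrightarrow>
     tabloid_space.subspace U \<and> (\<forall>\<pi>. \<pi> permutes {1..n} \<longrightarrow> (\<forall>v\<in>U. act \<pi> v \<in> U))"

definition is_direct_summand ::
    "nat \<Rightarrow> (tabloid \<Rightarrow>\<^sub>0 'a::field) set \<Rightarrow> (tabloid \<Rightarrow>\<^sub>0 'a) set \<Rightarrow> bool" where
  "is_direct_summand n U V \<longleftrightarrow> is_submodule n U \<and>
     (\<exists>W. is_submodule n W \<and> U \<inter> W = {0} \<and> V = {u + w |u w. u \<in> U \<and> w \<in> W})"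

end

theory Submission
  imports Defs
begin

text \<open>
  In characteristic 2 a tabloid is a row word \<open>w\<close> (the map sending an entry to its row), a polytabloid
  depends only on the column word \<open>s\<close> of its tableau, and the coefficient of \<open>w\<close> in \<open>e\<^sub>s\<close> is 1 iff
  \<open>i \<mapsto> (w i, s i)\<close> is a bijection onto the diagram.

  A one-dimensional summand is spanned by the sum \<open>\<Omega>\<close> of all tabloids, and the projection onto it takes
  the same value on all polytabloids. So \<open>\<Omega> = \<Sum>\<^sub>k c\<^sub>k e\<^bsub>s\<^sub>k\<^esub>\<close> with \<open>\<Sum>\<^sub>k c\<^sub>k \<noteq> 0\<close>, while \<open>\<Omega> \<in> Sp\<close> and the
  existence of the projection force parity conditions on binomial coefficients of neighbouring row and
  column lengths. Outside the hooks these conditions give \<open>a = \<lambda>\<^sub>1 \<equiv> 3\<close> modulo 4 and leave two cases: all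
  columns have odd length and \<open>n \<equiv> 1\<close> modulo 4, or \<open>\<lambda>\<close> is a rectangle of that kind without its corner.
  The second case reduces to the first, since \<open>\<Omega>\<close> lifts to the rectangle.

  In the first case add two boxes to the first row. The parity conditions on the columns persist, so by
  Garnir straightening there still is a functional with value 1 on all polytabloids, that is, a set \<open>\<D>\<close>
  of row words on \<open>n + 2\<close> letters of which an odd number occurs in each \<open>e\<^sub>s\<close>. For each pair of letters
  put aside, \<open>\<Sum>\<^sub>k c\<^sub>k\<close> counts modulo 2 the words in \<open>\<D>\<close> with that pair in the first row. Summing over
  all pairs gives \<open>(n + 2 choose 2) \<Sum>\<^sub>k c\<^sub>k = |\<D>| (a + 2 choose 2)\<close>. The left binomial coefficient is
  odd and the right one even, so \<open>\<Sum>\<^sub>k c\<^sub>k = 0\<close>.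
\<close>

section \<open>Row words and column words\<close>

text \<open>The letter set and the diagram are parameters because later steps add and remove letters
  and boxes.\<close>

definition fits :: "'i set \<Rightarrow> (nat \<times> nat) set \<Rightarrow> ('i \<Rightarrow> nat) \<Rightarrow> ('i \<Rightarrow> nat) \<Rightarrow> bool" where
  "fits X D w s \<longleftrightarrow> bij_betw (\<lambda>i. (w i, s i)) X D"

definition has_content :: "'i set \<Rightarrow> ('i \<Rightarrow> nat) \<Rightarrow> (nat \<Rightarrow> nat) \<Rightarrow> bool" where
  "has_content X w R \<longleftrightarrow> (\<forall>r. card {i\<in>X. w i = r} = R r)"

text \<open>A shape is a row length function rather than a list, so that lengthening a row is a
  function update.\<close>

definition boxes :: "(nat \<Rightarrow> nat) \<Rightarrow> (nat \<times> nat) set" where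
  "boxes R = {(r, j). j < R r}"

text \<open>This one equivalence also forces \<open>R\<close> and \<open>C\<close> to decrease
  weakly and to vanish eventually, so it carries the whole partition condition.\<close>

definition conjugate :: "(nat \<Rightarrow> nat) \<Rightarrow> (nat \<Rightarrow> nat) \<Rightarrow> bool" where
  "conjugate R C \<longleftrightarrow> (\<forall>r j. j < R r \<longleftrightarrow> r < C j)"

text \<open>Used for both kinds of words: it redistributes the letters of \<open>Z\<close> over two
  rows of a row word or over two columns of a column word.\<close>

definition recolour :: "'i set \<Rightarrow> nat \<Rightarrow> nat \<Rightarrow> ('i \<Rightarrow> nat) \<Rightarrow> 'i set \<Rightarrow> 'i \<Rightarrow> nat" where
  "recolour Z p q w B = (\<lambda>i. if i \<in> Z then (if i \<in> B then q else p) else w i)"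

text \<open>The map \<open>f\<close> matches the elements satisfying \<open>P\<close> with the
  others.\<close>

lemma even_card_involution:
  assumes "finite A"
    and "\<And>x. x \<in> A \<Longrightarrow> f x \<in> A \<and> f (f x) = x \<and> (P (f x) \<longleftrightarrow> \<not> P x)"
  shows "even (card A)"
proof -
  have "bij_betw f {x\<in>A. P x} {x\<in>A. \<not> P x}"
    by (rule bij_betwI[where g = f]) (use assms(2) in auto)
  then have "card {x\<in>A. P x} = card {x\<in>A. \<not> P x}"
    by (rule bij_betw_same_card)
  moreover have "card A = card {x\<in>A. P x} + card {x\<in>A. \<not> P x}"
    using assms(1) card_Int_Diff[of A "{x. P x}"] by (simp add: Int_def set_diff_eq)
  ultimately show ?thesis by simp
qed

lemma fits_swap: "fits X D w s \<longleftrightarrow> fits X (prod.swap ` D) s w"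
proof -
  have *: "fits X (prod.swap ` D) s w" if "fits X D w s" for D and w s :: "'a \<Rightarrow> nat"
    using bij_betw_trans[of "\<lambda>i. (w i, s i)" X D prod.swap "prod.swap ` D"] that
    by (simp add: fits_def comp_def bij_betw_def)
  show ?thesis using *[of D w s] *[of "prod.swap ` D" s w] by (auto simp: image_image)
qed

lemma fits_cong:
  assumes "\<And>i. i \<in> X \<Longrightarrow> w i = w' i" "\<And>i. i \<in> X \<Longrightarrow> s i = s' i"
  shows "fits X D w s \<longleftrightarrow> fits X D w' s'"
  unfolding fits_def by (rule bij_betw_cong) (simp add: assms)

lemma fits_permute:
  assumes "\<pi> permutes X"
  shows "fits X D (w \<circ> \<pi>) (s \<circ> \<pi>) \<longleftrightarrow> fits X D w s"
proof -
  have "bij_betw (\<lambda>i. (w i, s i)) X D = bij_betw ((\<lambda>i. (w i, s i)) \<circ> \<pi>) X D"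
    by (rule bij_betw_comp_iff) (rule permutes_imp_bij[OF assms])
  then show ?thesis unfolding fits_def comp_def by simp
qed

lemma fits_transpose:
  assumes "fits X D w s" "x \<in> X" "y \<in> X" "s x = s y"
  shows "fits X D (w \<circ> transpose x y) s"
proof -
  have p: "transpose x y permutes X" using assms by (intro permutes_swap_id)
  have "fits X D (w \<circ> transpose x y) (s \<circ> transpose x y)"
    using assms fits_permute[OF p] by blast
  moreover have "s \<circ> transpose x y = s" using assms(4) by (auto simp: transpose_def)
  ultimately show ?thesis by simp
qed

lemma fits_inj: "fits X D w s \<Longrightarrow> x \<in> X \<Longrightarrow> y \<in> X \<Longrightarrow> w x = w y \<Longrightarrow> s x = s y \<Longrightarrow> x = y"
  by (auto simp: fits_def bij_betw_def inj_on_def)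

lemma fits_mem: "fits X D w s \<Longrightarrow> x \<in> X \<Longrightarrow> (w x, s x) \<in> D"
  by (auto simp: fits_def bij_betw_def)

lemma card_row_fits:
  assumes "fits X D w s"
  shows "card {i\<in>X. w i = r} = card {j. (r, j) \<in> D}"
proof (rule bij_betw_same_card)
  show "bij_betw s {i\<in>X. w i = r} {j. (r, j) \<in> D}"
    unfolding bij_betw_def
  proof (intro conjI equalityI subsetI)
    show "inj_on s {i \<in> X. w i = r}" using fits_inj[OF assms] by (auto intro!: inj_onI)
  next
    fix j assume "j \<in> {j. (r, j) \<in> D}"
    then have "(r, j) \<in> (\<lambda>i. (w i, s i)) ` X" using assms by (simp add: fits_def bij_betw_def)
    then show "j \<in> s ` {i \<in> X. w i = r}" by auto
  qed (use fits_mem[OF assms] in auto)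
qed

lemma conjugate_sym: "conjugate R C \<Longrightarrow> conjugate C R"
  by (simp add: conjugate_def)

lemma swap_boxes: "conjugate R C \<Longrightarrow> prod.swap ` boxes R = boxes C"
  unfolding boxes_def conjugate_def by (auto simp: image_iff)

lemma content_row_fits: "fits X (boxes R) w s \<Longrightarrow> has_content X w R"
  using card_row_fits[of X "boxes R" w s] by (simp add: has_content_def boxes_def flip: lessThan_def)

lemma fits_sym: "conjugate R C \<Longrightarrow> fits X (boxes R) w s \<longleftrightarrow> fits X (boxes C) s w"
  using fits_swap[of X "boxes R"] swap_boxes by metis

lemma content_col_fits: "conjugate R C \<Longrightarrow> fits X (boxes R) w s \<Longrightarrow> has_content X s C"
  using fits_sym content_row_fits by blast

lemma conjugateD: "conjugate R C \<Longrightarrow> j < R r \<longleftrightarrow> r < C j"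
  by (simp add: conjugate_def)

lemma conjugate_antimono:
  assumes "conjugate R C" "r \<le> r'"
  shows "R r' \<le> R r"
proof (rule ccontr)
  assume "\<not> R r' \<le> R r"
  then have "r' < C (R r)" using conjugateD[OF assms(1), of "R r" r'] by simp
  then show False using conjugateD[OF assms(1), of "R r" r] assms(2) by simp
qed

section \<open>Exchange relations for rows and columns\<close>

lemma even_card_recolour_fits:
  assumes "finite Z" "Z \<subseteq> X" "p \<noteq> q" "x \<in> Z - Y" "y \<in> Z - Y" "x \<noteq> y" "s x = s y"
  shows "even (card {B. Y \<subseteq> B \<and> B \<subseteq> Z \<and> card B = m \<and> fits X D (recolour Z p q w B) s})"
    (is "even (card ?A)")
proof (rule even_card_involution[where f = "(`) (transpose x y)" and P = "\<lambda>B. x \<in> B"])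
  show "finite ?A" by (rule finite_subset[of _ "Pow Z"]) (use assms in auto)
next
  fix B assume B: "B \<in> ?A"
  let ?t = "transpose x y"
  have t: "i \<in> ?t ` S \<longleftrightarrow> ?t i \<in> S" for i and S :: "'a set"
    by (metis image_iff transpose_involutory)
  \<comment> \<open>Two letters of one column cannot share a row, so exactly one of \<open>x\<close>
    and \<open>y\<close> lies in \<open>B\<close>. Exchanging them therefore changes
    \<open>B\<close> and pairs up the admissible sets.\<close>
  have one: "y \<in> B \<longleftrightarrow> x \<notin> B"
  proof (rule ccontr)
    assume "\<not> ?thesis"
    then have "recolour Z p q w B x = recolour Z p q w B y" using assms by (auto simp: recolour_def)
    then show False using fits_inj[of X D "recolour Z p q w B" s x y] B assms by auto
  qed
  have "recolour Z p q w (?t ` B) = recolour Z p q w B \<circ> ?t"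
    using assms by (auto simp: recolour_def fun_eq_iff t transpose_def)
  then have "fits X D (recolour Z p q w (?t ` B)) s"
    using fits_transpose[of X D "recolour Z p q w B" s x y] B assms by auto
  moreover have "Y \<subseteq> ?t ` B" using B assms by (auto simp: t transpose_def)
  moreover have "?t ` B \<subseteq> Z" using B assms by (auto simp: transpose_def)
  moreover have "card (?t ` B) = m" using B by (simp add: card_image)
  ultimately show "?t ` B \<in> ?A \<and> ?t ` ?t ` B = B \<and> (x \<in> ?t ` B \<longleftrightarrow> x \<notin> B)"
    using one by (auto simp: t image_image)
qed

lemma card_between:
  assumes "finite Z" "Y \<subseteq> Z" "card Y \<le> m"
  shows "card {B. Y \<subseteq> B \<and> B \<subseteq> Z \<and> card B = m} = (card Z - card Y) choose (m - card Y)"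
proof -
  have fY: "finite Y" using assms finite_subset by blast
  have "bij_betw (\<lambda>B. B - Y) {B. Y \<subseteq> B \<and> B \<subseteq> Z \<and> card B = m} {B. B \<subseteq> Z - Y \<and> card B = m - card Y}"
  proof (rule bij_betwI[where g = "\<lambda>B. B \<union> Y"])
    show "(\<lambda>B. B \<union> Y) \<in> {B. B \<subseteq> Z - Y \<and> card B = m - card Y} \<rightarrow> {B. Y \<subseteq> B \<and> B \<subseteq> Z \<and> card B = m}"
    proof
      fix B assume B: "B \<in> {B. B \<subseteq> Z - Y \<and> card B = m - card Y}"
      then have "card (B \<union> Y) = card B + card Y"
        using fY assms(1) finite_subset[of B Z] by (intro card_Un_disjoint) auto
      then show "B \<union> Y \<in> {B. Y \<subseteq> B \<and> B \<subseteq> Z \<and> card B = m}" using B assms by auto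
    qed
  qed (use assms fY card_Diff_subset in auto)
  then have "card {B. Y \<subseteq> B \<and> B \<subseteq> Z \<and> card B = m} = card {B. B \<subseteq> Z - Y \<and> card B = m - card Y}"
    by (rule bij_betw_same_card)
  also have "\<dots> = card (Z - Y) choose (m - card Y)" using assms by (intro n_subsets) auto
  finally show ?thesis using assms fY by (simp add: card_Diff_subset)
qed

text \<open>The letters of \<open>Y\<close> are too few to meet every column of row
  \<open>Suc r\<close>, so some column \<open>j\<close> is missed. For one admissible
  \<open>B\<close>, the letters in rows \<open>r\<close> and \<open>Suc r\<close> of column
  \<open>j\<close> lie in \<open>Z\<close> outside \<open>Y\<close>; exchanging these two letters
  pairs up all admissible sets.\<close>

lemma even_card_row_exchange:
  assumes R: "conjugate R C" and X: "finite X" "Z \<subseteq> X" and Y: "card Y < R (Suc r)" "Y \<subseteq> Z"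
    and Z: "\<And>i. i \<in> X \<Longrightarrow> w i \<in> {r, Suc r} \<Longrightarrow> i \<in> Z"
  shows "even (card {B. Y \<subseteq> B \<and> B \<subseteq> Z \<and> card B = R (Suc r) \<and>
           fits X (boxes R) (recolour Z r (Suc r) w B) s})" (is "even (card ?A)")
proof (cases "?A = {}")
  case False
  then obtain B where B: "Y \<subseteq> B" "B \<subseteq> Z" "fits X (boxes R) (recolour Z r (Suc r) w B) s" by auto
  have fY: "finite Y" by (rule finite_subset[OF Y(2) finite_subset[OF X(2,1)]])
  have "card (s ` Y) < card {..<R (Suc r)}" using card_image_le[OF fY, of s] Y by simp
  then have "\<not> {..<R (Suc r)} \<subseteq> s ` Y"
    using card_mono[OF finite_imageI[OF fY], of "{..<R (Suc r)}" s] by linarith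
  then obtain j where j: "j < R (Suc r)" "j \<notin> s ` Y" by auto
  have j': "j < R r" using conjugate_antimono[OF R, of r "Suc r"] j by simp
  have im: "(\<lambda>i. (recolour Z r (Suc r) w B i, s i)) ` X = boxes R"
    using B(3) by (simp add: fits_def bij_betw_def)
  have "(r, j) \<in> boxes R" "(Suc r, j) \<in> boxes R" using j j' by (auto simp: boxes_def)
  then obtain x y where x: "x \<in> X" "recolour Z r (Suc r) w B x = r" "s x = j"
    and y: "y \<in> X" "recolour Z r (Suc r) w B y = Suc r" "s y = j"
    unfolding im[symmetric] by auto
  have "x \<in> Z" "y \<in> Z" using x y Z by (auto simp: recolour_def split: if_splits)
  moreover have "x \<noteq> y" using x y by auto
  moreover have "x \<notin> Y" "y \<notin> Y" using x y j by (metis imageI)+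
  ultimately show ?thesis
    by (intro even_card_recolour_fits[where x = x and y = y] finite_subset[OF X(2,1)] X(2))
      (use x y in auto)
next
  case True
  show ?thesis unfolding True by simp
qed

text \<open>The Garnir relation, without signs because of characteristic 2.\<close>

lemma even_card_column_exchange:
  assumes R: "conjugate R C" and X: "finite X" "Z \<subseteq> X" and Z: "card Z > C j" and j: "j < j'"
  shows "even (card {B. B \<subseteq> Z \<and> card B = m \<and> fits X (boxes R) w (recolour Z j j' s B)})" (is "even (card ?A)")
proof (cases "?A = {}")
  case False
  then obtain B where B: "fits X (boxes R) w (recolour Z j j' s B)" by auto
  \<comment> \<open>Columns \<open>j\<close> and \<open>j'\<close> are no longer than
    \<open>C j\<close>, so \<open>w\<close> maps the more than \<open>C j\<close> letters of
    \<open>Z\<close> into \<open>C j\<close> rows, and two of them share a row.\<close>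
  have "w i \<in> {..<C j}" if "i \<in> Z" for i
  proof -
    have "(w i, recolour Z j j' s B i) \<in> boxes R" using B that X by (auto intro: fits_mem)
    then have "w i < C (recolour Z j j' s B i)" using R by (simp add: boxes_def conjugate_def)
    moreover have "recolour Z j j' s B i \<in> {j, j'}" using that by (auto simp: recolour_def)
    ultimately show ?thesis using conjugate_antimono[OF conjugate_sym[OF R], of j j'] j by auto
  qed
  then have "w ` Z \<subseteq> {..<C j}" by auto
  then have "card (w ` Z) \<le> C j" using card_mono[of "{..<C j}" "w ` Z"] by simp
  then have "\<not> inj_on w Z" using Z pigeonhole[of w Z] by simp
  then obtain x y where "x \<in> Z" "y \<in> Z" "x \<noteq> y" "w x = w y" by (auto simp: inj_on_def)
  \<comment> \<open>With the roles of rows and columns exchanged, the two letters in a common row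
    provide the pairing.\<close>
  then show ?thesis
    using even_card_recolour_fits[of Z X j j' x "{}" y w m "boxes C" s] finite_subset[OF X(2,1)] X(2) j
    by (simp add: fits_sym[OF R])
next
  case True
  show ?thesis unfolding True by simp
qed

section \<open>Standard column words\<close>

text \<open>This is the row of \<open>i\<close> once every column of \<open>s\<close> is sorted to
  increase downwards.\<close>

definition column_rank :: "nat set \<Rightarrow> (nat \<Rightarrow> nat) \<Rightarrow> nat \<Rightarrow> nat" where
  "column_rank X s i = card {k\<in>X. s k = s i \<and> k < i}"

text \<open>A numerical substitute for the dominance order: it grows when larger letters trade
  places with smaller ones in later rows or, for a column word, in later columns.\<close>

definition weight :: "nat set \<Rightarrow> (nat \<Rightarrow> nat) \<Rightarrow> nat" where
  "weight X w = (\<Sum>i\<in>X. i * w i)"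

lemma fits_iff_columns:
  assumes R: "conjugate R C"
  shows "fits X (boxes R) w s \<longleftrightarrow> (\<forall>j. bij_betw w {i\<in>X. s i = j} {..<C j})" (is "?l \<longleftrightarrow> ?r")
proof
  assume f: ?l
  have im: "(\<lambda>i. (w i, s i)) ` X = boxes R" using f by (simp add: fits_def bij_betw_def)
  show ?r
  proof
    fix j
    have "inj_on w {i \<in> X. s i = j}" using fits_inj[OF f] by (auto intro!: inj_onI)
    moreover have "w ` {i \<in> X. s i = j} = {..<C j}"
    proof (intro equalityI subsetI)
      fix r assume "r \<in> {..<C j}"
      then have "(r, j) \<in> boxes R" using R by (simp add: boxes_def conjugate_def)
      then show "r \<in> w ` {i \<in> X. s i = j}" unfolding im[symmetric] by auto
    qed (use fits_mem[OF f] R in \<open>auto simp: boxes_def conjugate_def\<close>)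
    ultimately show "bij_betw w {i\<in>X. s i = j} {..<C j}" by (simp add: bij_betw_def)
  qed
next
  assume r: ?r
  then have inj: "inj_on w {i\<in>X. s i = j}" and im: "w ` {i\<in>X. s i = j} = {..<C j}" for j
    by (auto simp: bij_betw_def)
  show ?l
    unfolding fits_def bij_betw_def
  proof (intro conjI equalityI subsetI)
    show "inj_on (\<lambda>i. (w i, s i)) X" using inj by (auto simp: inj_on_def)
  next
    fix b assume "b \<in> (\<lambda>i. (w i, s i)) ` X"
    then obtain i where i: "i \<in> X" "b = (w i, s i)" by auto
    then have "w i \<in> {..<C (s i)}" using im[of "s i"] by blast
    then show "b \<in> boxes R" using R i by (simp add: boxes_def conjugate_def)
  next
    fix b assume "b \<in> boxes R"
    then obtain r' j where b: "b = (r', j)" "r' \<in> {..<C j}" using R by (auto simp: boxes_def conjugate_def)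
    then have "r' \<in> w ` {i\<in>X. s i = j}" using im by simp
    then show "b \<in> (\<lambda>i. (w i, s i)) ` X" using b by auto
  qed
qed

lemma column_rank_less:
  assumes "finite X" "i \<in> X" "k \<in> X" "s i = s k" "i < k"
  shows "column_rank X s i < column_rank X s k"
  unfolding column_rank_def by (rule psubset_card_mono) (use assms in auto)

text \<open>Consequently every column word of the right content belongs to some tableau.\<close>

lemma fits_column_rank:
  assumes R: "conjugate R C" and X: "finite X" and s: "has_content X s C"
  shows "fits X (boxes R) (column_rank X s) s"
  unfolding fits_iff_columns[OF R]
proof
  fix j
  let ?K = "{i\<in>X. s i = j}"
  have inj: "inj_on (column_rank X s) ?K"
  proof (rule linorder_inj_onI')
    fix i k assume "i \<in> ?K" "k \<in> ?K" "i < k"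
    then have "column_rank X s i < column_rank X s k" using column_rank_less[OF X, of i k s] by simp
    then show "column_rank X s i \<noteq> column_rank X s k" by simp
  qed
  have c: "card ?K = C j" using s by (simp add: has_content_def)
  have "column_rank X s i < C j" if "i \<in> ?K" for i
    unfolding c[symmetric] column_rank_def by (rule psubset_card_mono) (use X that in auto)
  then have "column_rank X s ` ?K \<subseteq> {..<C j}" by auto
  then have "column_rank X s ` ?K = {..<C j}"
    by (rule card_subset_eq[rotated]) (auto simp: card_image[OF inj] c)
  then show "bij_betw (column_rank X s) ?K {..<C j}" using inj by (simp add: bij_betw_def)
qed

text \<open>The letters of a column fill an initial segment of rows. If they increase downwards, the
  rows above \<open>i\<close> hold exactly the smaller letters of its column.\<close>

lemma column_increasing_eq_column_rank:
  assumes R: "conjugate R C" and f: "fits X (boxes R) w s" and i: "i \<in> X"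
    and inc: "\<And>x y. x \<in> X \<Longrightarrow> y \<in> X \<Longrightarrow> s x = s y \<Longrightarrow> x < y \<Longrightarrow> w x < w y"
  shows "w i = column_rank X s i"
proof -
  have b: "bij_betw w {k\<in>X. s k = s i} {..<C (s i)}" using f fits_iff_columns[OF R] by auto
  have "bij_betw w {k\<in>X. s k = s i \<and> k < i} {..<w i}"
    unfolding bij_betw_def
  proof (intro conjI equalityI subsetI)
    show "inj_on w {k\<in>X. s k = s i \<and> k < i}" using b by (auto simp: bij_betw_def inj_on_def)
  next
    fix r assume r: "r \<in> {..<w i}"
    moreover have "w i < C (s i)" using b i by (auto simp: bij_betw_def)
    ultimately have "r \<in> w ` {k\<in>X. s k = s i}" using b by (simp add: bij_betw_def)
    then obtain k where k: "k \<in> X" "s k = s i" "r = w k" by auto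
    then have "k < i" using inc[of i k] r i by (cases k i rule: linorder_cases) auto
    then show "r \<in> w ` {k\<in>X. s k = s i \<and> k < i}" using k by auto
  qed (use inc i in auto)
  then show ?thesis unfolding column_rank_def using bij_betw_same_card by fastforce
qed

text \<open>The rearrangement inequality for a single transposition.\<close>

lemma sum_swap_less:
  assumes X: "finite (X :: nat set)" and x: "x \<in> X" "y \<in> X" "x < y" "w y < (w x :: nat)"
  shows "(\<Sum>i\<in>X. i * w i) < (\<Sum>i\<in>X. i * (w \<circ> transpose x y) i)"
proof -
  let ?Z = "X - {x, y}"
  have s: "(\<Sum>i\<in>X. f i) = f x + f y + (\<Sum>i\<in>?Z. f i)" for f :: "nat \<Rightarrow> nat"
  proof -
    have "X = insert x (insert y ?Z)" using x by auto
    then have "sum f X = sum f (insert x (insert y ?Z))" by simp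
    then show ?thesis using X x by simp
  qed
  have "(\<Sum>i\<in>?Z. i * (w \<circ> transpose x y) i) = (\<Sum>i\<in>?Z. i * w i)"
    by (rule sum.cong) (auto simp: transpose_def)
  moreover have "x * w x + y * w y < x * w y + y * w x"
  proof -
    obtain d e where "y = x + Suc d" "w x = w y + Suc e"
      using x(3,4) by (metis less_iff_Suc_add add_Suc_right)
    then show ?thesis by (simp add: algebra_simps)
  qed
  ultimately show ?thesis unfolding s[of "\<lambda>i. i * w i"] s[of "\<lambda>i. i * (w \<circ> transpose x y) i"] by simp
qed

lemma weight_le:
  assumes R: "conjugate R C" and f: "fits X (boxes R) w s"
  shows "weight X w \<le> (\<Sum>i\<in>X. i * C 0)"
  unfolding weight_def
proof (rule sum_mono)
  fix i assume "i \<in> X"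
  then have "w i < C (s i)" using fits_mem[OF f] R by (simp add: boxes_def conjugate_def)
  also have "C (s i) \<le> C 0" using conjugate_antimono[OF conjugate_sym[OF R]] by simp
  finally show "i * w i \<le> i * C 0" by simp
qed

text \<open>Columns are sorted by transpositions. Each one removes an inversion and raises the
  weight, which is bounded, so the process ends at the increasing word.\<close>

lemma weight_less_column_rank:
  assumes R: "conjugate R C" and X: "finite X" and f: "fits X (boxes R) w s"
  shows "(\<forall>i\<in>X. w i = column_rank X s i) \<or> weight X w < weight X (column_rank X s)"
  using f
proof (induction "(\<Sum>i\<in>X. i * C 0) - weight X w" arbitrary: w rule: less_induct)
  case less
  show ?case
  proof (cases "\<forall>x\<in>X. \<forall>y\<in>X. s x = s y \<longrightarrow> x < y \<longrightarrow> w x < w y")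
    case True
    then show ?thesis using column_increasing_eq_column_rank[OF R less.prems] by blast
  next
    case False
    then obtain x y where x: "x \<in> X" "y \<in> X" "s x = s y" "x < y" "\<not> w x < w y" by blast
    then have "w y < w x" using fits_inj[OF less.prems, of x y] by (cases "w x" "w y" rule: linorder_cases) auto
    then have l: "weight X w < weight X (w \<circ> transpose x y)"
      unfolding weight_def using x X by (intro sum_swap_less) auto
    have f': "fits X (boxes R) (w \<circ> transpose x y) s"
      using fits_transpose[OF less.prems] x by blast
    have "(\<forall>i\<in>X. (w \<circ> transpose x y) i = column_rank X s i) \<or>
        weight X (w \<circ> transpose x y) < weight X (column_rank X s)"
      using less.hyps[of "w \<circ> transpose x y"] l weight_le[OF R f'] f' by linarith
    moreover have "weight X (w \<circ> transpose x y) = weight X (column_rank X s)"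
      if "\<forall>i\<in>X. (w \<circ> transpose x y) i = column_rank X s i"
      unfolding weight_def using that by (intro sum.cong) auto
    ultimately show ?thesis using l by linarith
  qed
qed

text \<open>Columns increase by construction of \<open>column_rank\<close>, so only the rows need a
  condition, and standardness becomes a property of the column word alone.\<close>

definition standard :: "nat set \<Rightarrow> (nat \<Rightarrow> nat) \<Rightarrow> (nat \<Rightarrow> nat) \<Rightarrow> bool" where
  "standard X C s \<longleftrightarrow> has_content X s C \<and>
     (\<forall>i\<in>X. \<forall>k\<in>X. column_rank X s i = column_rank X s k \<longrightarrow> s i < s k \<longrightarrow> i < k)"

text \<open>In a standard tableau the rows increase, so the column of \<open>i\<close> is the number
  of smaller letters in its row. Hence the row word determines the column word.\<close>

lemma standard_determined:
  assumes R: "conjugate R C" and X: "finite X" and s: "standard X C s" "standard X C s'"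
    and eq: "\<And>i. i \<in> X \<Longrightarrow> column_rank X s i = column_rank X s' i" and i: "i \<in> X"
  shows "s i = s' i"
proof -
  have *: "t i = column_rank X (column_rank X t) i" if t: "standard X C t" for t
  proof (rule column_increasing_eq_column_rank[OF conjugate_sym[OF R]])
    have "fits X (boxes R) (column_rank X t) t" using fits_column_rank[OF R X] t by (simp add: standard_def)
    then show f: "fits X (boxes C) t (column_rank X t)" by (simp add: fits_sym[OF R])
    fix x y assume xy: "x \<in> X" "y \<in> X" "column_rank X t x = column_rank X t y" "x < y"
    have "t x \<noteq> t y" using fits_inj[OF f xy(1,2)] xy(3,4) by auto
    moreover have "\<not> t y < t x" using t xy unfolding standard_def by (metis order.asym)
    ultimately show "t x < t y" by simp
  qed (fact i)
  have "column_rank X (column_rank X s) i = column_rank X (column_rank X s') i"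
    unfolding column_rank_def[of X "column_rank X s"] column_rank_def[of X "column_rank X s'"]
    using eq i by (intro arg_cong[of _ _ card]) auto
  then show ?thesis using *[OF s(1)] *[OF s(2)] by simp
qed

lemma finite_words:
  assumes X: "finite X"
  shows "finite {w. w \<in> extensional X \<and> (\<exists>s. fits X (boxes R) w s)}"
proof (cases "\<exists>w s. fits X (boxes R) w s")
  case True
  then have "finite (boxes R)" using X by (auto simp: fits_def dest: bij_betw_finite)
  then have "finite (X \<rightarrow>\<^sub>E fst ` boxes R)" using X by (intro finite_PiE) auto
  moreover have "{w. w \<in> extensional X \<and> (\<exists>s. fits X (boxes R) w s)} \<subseteq> X \<rightarrow>\<^sub>E fst ` boxes R"
  proof
    fix w assume "w \<in> {w. w \<in> extensional X \<and> (\<exists>s. fits X (boxes R) w s)}"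
    then obtain s where w: "w \<in> extensional X" and s: "fits X (boxes R) w s" by auto
    have "w x \<in> fst ` boxes R" if "x \<in> X" for x using imageI[OF fits_mem[OF s that], of fst] by simp
    then show "w \<in> X \<rightarrow>\<^sub>E fst ` boxes R" using w by (simp add: PiE_def)
  qed
  ultimately show ?thesis by (rule finite_subset[rotated])
qed simp

text \<open>The induction works because the system is triangular: among the row words fitting \<open>s\<close>, \<^term>\<open>column_rank X s\<close> has the largest weight.\<close>

lemma exists_odd_standard:
  assumes R: "conjugate R C" and X: "finite X"
  shows "\<exists>\<D>. (\<forall>w\<in>\<D>. w \<in> extensional X \<and> (\<exists>s. fits X (boxes R) w s) \<and> weight X w < N) \<and>
    (\<forall>s. standard X C s \<longrightarrow> weight X (column_rank X s) < N \<longrightarrow> odd (card {w\<in>\<D>. fits X (boxes R) w s}))"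
proof (induction N)
  case (Suc N)
  then obtain \<D> where D: "\<And>w. w\<in>\<D> \<Longrightarrow> w \<in> extensional X \<and> (\<exists>s. fits X (boxes R) w s) \<and> weight X w < N"
    and odd: "\<And>s. standard X C s \<Longrightarrow> weight X (column_rank X s) < N \<Longrightarrow> odd (card {w\<in>\<D>. fits X (boxes R) w s})"
    by blast
  have fin: "finite \<D>" by (rule finite_subset[OF _ finite_words[OF X, of R]]) (use D in auto)
  let ?r = "\<lambda>s. restrict (column_rank X s) X"
  let ?f = "fits X (boxes R)"
  \<comment> \<open>The corrections at weight \<open>N\<close>: the sorted row word of
    \<open>s\<close> is added exactly when the parity for \<open>s\<close> is still wrong.\<close>
  define \<N> where "\<N> = {?r s |s. standard X C s \<and> weight X (column_rank X s) = N \<and> even (card {w\<in>\<D>. ?f w s})}"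
  have wr: "weight X (?r s) = weight X (column_rank X s)" for s
    unfolding weight_def by (rule sum.cong) auto
  have fr: "?f (?r s) s" if "has_content X s C" for s
    using fits_column_rank[OF R X that] by (subst fits_cong[of X _ "column_rank X s" s s]) auto
  have N: "w \<in> extensional X \<and> (\<exists>s. ?f w s) \<and> weight X w = N" if wN: "w \<in> \<N>" for w
  proof -
    obtain s where s: "w = ?r s" "standard X C s" "weight X (column_rank X s) = N"
      using wN unfolding \<N>_def by blast
    then have "?f w s" using fr by (simp add: standard_def)
    then show ?thesis using s wr by auto
  qed
  have "odd (card {w\<in>\<D> \<union> \<N>. ?f w s})" if s: "standard X C s" and le: "weight X (column_rank X s) < Suc N" for s
  proof (cases "weight X (column_rank X s) = N")
    case False
    then have "weight X (column_rank X s) < N" using le by simp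
    \<comment> \<open>A new word has weight \<open>N\<close>, which exceeds the largest weight of a
      word fitting this \<open>s\<close>, so parities settled before are not disturbed.\<close>
    moreover have "\<not> ?f w s" if "w \<in> \<N>" for w
    proof
      assume f: "?f w s"
      have "weight X w = weight X (column_rank X s)" if "\<forall>i\<in>X. w i = column_rank X s i"
        unfolding weight_def using that by (intro sum.cong) auto
      then have "weight X w \<le> weight X (column_rank X s)" using weight_less_column_rank[OF R X f] by auto
      then show False using N[OF that] \<open>weight X (column_rank X s) < N\<close> by simp
    qed
    then have "{w\<in>\<D> \<union> \<N>. ?f w s} = {w\<in>\<D>. ?f w s}" by auto
    ultimately show ?thesis using odd[OF s] by simp
  next
    case True
    \<comment> \<open>Among the words fitting \<open>s\<close>, only the sorted one reaches weight
      \<open>N\<close>.\<close>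
    have new: "w = ?r s" if "w \<in> \<N>" "?f w s" for w
      using weight_less_column_rank[OF R X that(2)] N[OF that(1)] True
      by (intro extensionalityI[of w X]) auto
    have "?r s \<in> \<N> \<longleftrightarrow> even (card {w\<in>\<D>. ?f w s})"
    proof
      \<comment> \<open>The word may have been added on behalf of another standard word
        \<open>s'\<close>, but then \<open>s\<close> and \<open>s'\<close> agree on
        \<open>X\<close>.\<close>
      assume "?r s \<in> \<N>"
      then obtain s' where s': "?r s = ?r s'" "standard X C s'" "even (card {w\<in>\<D>. ?f w s'})"
        unfolding \<N>_def by blast
      have "column_rank X s i = column_rank X s' i" if "i \<in> X" for i
        using fun_cong[OF s'(1), of i] that by simp
      then have "\<And>i. i \<in> X \<Longrightarrow> s i = s' i" using standard_determined[OF R X s s'(2)] by blast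
      then have "?f w s = ?f w s'" for w by (rule fits_cong[OF refl])
      then show "even (card {w\<in>\<D>. ?f w s})" using s' by simp
    next
      assume "even (card {w\<in>\<D>. ?f w s})"
      then show "?r s \<in> \<N>" unfolding \<N>_def using s True by blast
    qed
    moreover have "?r s \<notin> \<D>"
    proof
      assume "?r s \<in> \<D>"
      then have "weight X (?r s) < N" using D by blast
      then show False using wr True by simp
    qed
    moreover have "{w\<in>\<D> \<union> \<N>. ?f w s} = (if ?r s \<in> \<N> then insert (?r s) {w\<in>\<D>. ?f w s} else {w\<in>\<D>. ?f w s})"
    proof -
      have fs: "?f (?r s) s" using fr s by (simp add: standard_def)
      show ?thesis
      proof (cases "?r s \<in> \<N>")
        case True
        then have "{w\<in>\<D> \<union> \<N>. ?f w s} = insert (?r s) {w\<in>\<D>. ?f w s}" using new fs by blast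
        then show ?thesis using True by simp
      next
        case False
        then have "{w\<in>\<D> \<union> \<N>. ?f w s} = {w\<in>\<D>. ?f w s}" using new by blast
        then show ?thesis using False by simp
      qed
    qed
    ultimately show ?thesis using fin by simp
  qed
  moreover have "w \<in> extensional X \<and> (\<exists>s. ?f w s) \<and> weight X w < Suc N" if "w \<in> \<D> \<union> \<N>" for w
    using that D[of w] N[of w] by auto
  ultimately show ?case by (intro exI[of _ "\<D> \<union> \<N>"] conjI ballI allI impI) simp_all
qed auto

section \<open>Garnir straightening\<close>

text \<open>The coefficient \<open>Suc (C j) choose i\<close> counts the terms of a Garnir relation
  on columns \<open>j\<close> and \<open>Suc j\<close>. Evenness makes the value 1 on all
  polytabloids compatible with these relations.\<close>

definition garnir :: "(nat \<Rightarrow> nat) \<Rightarrow> bool" where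
  "garnir C \<longleftrightarrow> (\<forall>j i. 1 \<le> i \<longrightarrow> i \<le> C (Suc j) \<longrightarrow> even (Suc (C j) choose i))"

lemma has_content_recolour:
  assumes X: "finite X" "Z \<subseteq> X" and w: "has_content X w R" and Z: "\<And>z. z \<in> Z \<Longrightarrow> w z = p \<or> w z = q"
    and pq: "p \<noteq> q" and B: "B \<subseteq> Z" "card B = card {z\<in>Z. w z = q}"
  shows "has_content X (recolour Z p q w B) R"
  unfolding has_content_def
proof
  fix r
  let ?v = "recolour Z p q w B"
  have fZ: "finite Z" using X finite_subset by auto
  have split: "card {x\<in>X. u x = r} = card {x\<in>X - Z. u x = r} + card {z\<in>Z. u z = r}" for u :: "'a \<Rightarrow> nat"
  proof -
    have "{x\<in>X. u x = r} = {x\<in>X - Z. u x = r} \<union> {z\<in>Z. u z = r}" using X by auto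
    moreover have "card ({x\<in>X - Z. u x = r} \<union> {z\<in>Z. u z = r}) = card {x\<in>X - Z. u x = r} + card {z\<in>Z. u z = r}"
      by (rule card_Un_disjoint) (use X fZ in auto)
    ultimately show ?thesis by simp
  qed
  have "{x\<in>X - Z. ?v x = r} = {x\<in>X - Z. w x = r}" by (auto simp: recolour_def)
  moreover have "card {z\<in>Z. ?v z = r} = card {z\<in>Z. w z = r}"
  proof -
    consider "r = q" | "r = p" | "r \<noteq> p" "r \<noteq> q" by blast
    then show ?thesis
    proof cases
      case 1
      then have "{z\<in>Z. ?v z = r} = B" using B pq by (auto simp: recolour_def)
      then show ?thesis using B 1 by simp
    next
      case 2
      have "{z\<in>Z. ?v z = r} = Z - B" using 2 B pq by (auto simp: recolour_def)
      moreover have "{z\<in>Z. w z = r} = Z - {z\<in>Z. w z = q}" using 2 pq Z by auto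
      moreover have "finite B" using B fZ finite_subset by auto
      ultimately show ?thesis using B fZ by (simp add: card_Diff_subset)
    next
      case 3
      then have "{z\<in>Z. ?v z = r} = {}" "{z\<in>Z. w z = r} = {}" using Z by (auto simp: recolour_def)
      then show ?thesis by (simp only:)
    qed
  qed
  ultimately have "card {x\<in>X. ?v x = r} = card {x\<in>X. w x = r}" using split[of ?v] split[of w] by simp
  then show "card {x\<in>X. ?v x = r} = R r" using w by (simp add: has_content_def)
qed

lemma sum_card_swap:
  assumes "finite A" "finite B"
  shows "(\<Sum>a\<in>A. card {b\<in>B. P a b}) = (\<Sum>b\<in>B. card {a\<in>A. P a b})"
proof -
  have "card {b\<in>B. P a b} = (\<Sum>b\<in>B. of_bool (P a b))" for a
    using assms by (simp add: sum.If_cases of_bool_def Int_def)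
  moreover have "card {a\<in>A. P a b} = (\<Sum>a\<in>A. of_bool (P a b))" for b
    using assms by (simp add: sum.If_cases of_bool_def Int_def)
  ultimately show ?thesis by (simp add: sum.swap[of _ A])
qed

text \<open>\<open>Y\<close> holds the smallest letters of \<open>Z\<close> and sits in the later
  column \<open>q\<close>. Any other set of the same size has a larger sum, so it brings larger
  letters into that column.\<close>

lemma weight_recolour_less:
  assumes X: "finite X" "Z \<subseteq> X" and Z: "\<And>z. z \<in> Z \<Longrightarrow> s z = (if z \<in> Y then q else p)"
    and pq: "p < q" and Y: "Y \<subseteq> Z" and B: "B \<subseteq> Z" "card B = card Y" "B \<noteq> Y"
    and yx: "\<And>y x. y \<in> Y \<Longrightarrow> x \<in> Z - Y \<Longrightarrow> y < (x :: nat)"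
  shows "weight X s < weight X (recolour Z p q s B)"
proof -
  have fZ: "finite Z" "finite Y" "finite B" using X Y B finite_subset by metis+
  have *: "weight X t = (\<Sum>x\<in>X - Z. x * t x) + (\<Sum>z\<in>Z. z * t z)" for t
    unfolding weight_def using X by (metis add.commute sum.subset_diff)
  have **: "(\<Sum>z\<in>Z. z * (if z \<in> S then q else p)) = p * \<Sum>Z + (q - p) * \<Sum>S" if "S \<subseteq> Z" for S
  proof -
    have "(\<Sum>z\<in>Z. z * (if z \<in> S then q else p)) = (\<Sum>z\<in>Z. p * z + (if z \<in> S then (q - p) * z else 0))"
      by (rule sum.cong) (use pq in \<open>auto simp: algebra_simps diff_mult_distrib2\<close>)
    also have "\<dots> = p * \<Sum>Z + (\<Sum>z\<in>Z. if z \<in> S then (q - p) * z else 0)"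
      by (simp add: sum.distrib sum_distrib_left)
    also have "(\<Sum>z\<in>Z. if z \<in> S then (q - p) * z else 0) = (q - p) * \<Sum>S"
      using that fZ by (simp add: sum.If_cases sum_distrib_left Int_absorb1)
    finally show ?thesis .
  qed
  have "\<Sum>Y < \<Sum>B"
  proof -
    have ne: "Y - B \<noteq> {}" using B fZ card_subset_eq[of B Y] by auto
    have c: "card (Y - B) = card (B - Y)"
      using B fZ by (metis card_Diff_subset_Int finite_Int Int_commute)
    \<comment> \<open>Both differences have the same size, and every letter of \<open>Y - B\<close>
      is smaller than every letter of \<open>B - Y\<close>, so both sums can be compared with
      multiples of the maximum of \<open>Y - B\<close>.\<close>
    define m where "m = Max (Y - B)"
    have mY: "m \<in> Y - B" unfolding m_def using ne fZ by (intro Max_in) auto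
    have "\<Sum>(Y - B) \<le> card (Y - B) * m"
      using sum_bounded_above[of "Y - B" "\<lambda>x. x" m] fZ by (simp add: m_def)
    also have "\<dots> < card (B - Y) * Suc m"
    proof -
      have "card (Y - B) > 0" using ne fZ by (metis card_gt_0_iff finite_Diff)
      then show ?thesis using c by simp
    qed
    also have "\<dots> \<le> \<Sum>(B - Y)"
      using sum_bounded_below[of "B - Y" "Suc m" "\<lambda>x. x"] yx[of m] mY B by force
    finally have "\<Sum>(Y - B) < \<Sum>(B - Y)" .
    moreover have "\<Sum>Y = \<Sum>(Y - B) + \<Sum>(Y \<inter> B)" "\<Sum>B = \<Sum>(B - Y) + \<Sum>(Y \<inter> B)"
      using fZ by (metis Int_commute add.commute sum.Int_Diff)+
    ultimately show ?thesis by simp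
  qed
  moreover have "(\<Sum>z\<in>Z. z * s z) = (\<Sum>z\<in>Z. z * (if z \<in> Y then q else p))"
    by (rule sum.cong) (use Z in auto)
  moreover have "(\<Sum>z\<in>Z. z * recolour Z p q s B z) = (\<Sum>z\<in>Z. z * (if z \<in> B then q else p))"
    by (rule sum.cong) (auto simp: recolour_def)
  moreover have "(\<Sum>x\<in>X - Z. x * recolour Z p q s B x) = (\<Sum>x\<in>X - Z. x * s x)"
    by (rule sum.cong) (auto simp: recolour_def)
  ultimately show ?thesis using **[OF Y] **[OF B(1)] pq unfolding *[of s] *[of "recolour Z p q s B"] by simp
qed

text \<open>Straightening transfers the parity from standard to all column words, by induction from
  large weight to small. In a Garnir relation for a nonstandard \<open>s\<close> all other terms
  have larger weight and hence odd counts. The total is even and the number of terms is even by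
  \<open>garnir\<close>, so the count for \<open>s\<close> is odd too.\<close>

lemma exists_odd_family:
  assumes R: "conjugate R C" and X: "finite (X :: nat set)" and g: "garnir C"
  shows "\<exists>\<D>. finite \<D> \<and> (\<forall>w\<in>\<D>. has_content X w R) \<and>
    (\<forall>s. has_content X s C \<longrightarrow> odd (card {w\<in>\<D>. fits X (boxes R) w s}))"
proof -
  let ?f = "fits X (boxes R)"
  define N where "N = Suc (\<Sum>i\<in>X. i * C 0)"
  obtain \<D> where D: "\<And>w. w\<in>\<D> \<Longrightarrow> w \<in> extensional X \<and> (\<exists>s. ?f w s)"
    and odd: "\<And>s. standard X C s \<Longrightarrow> weight X (column_rank X s) < N \<Longrightarrow> odd (card {w\<in>\<D>. ?f w s})"
    using exists_odd_standard[OF R X, of N] by blast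
  have fin: "finite \<D>" by (rule finite_subset[OF _ finite_words[OF X, of R]]) (use D in blast)
  have "odd (card {w\<in>\<D>. ?f w s})" if "has_content X s C" for s
    using that
  proof (induction "(\<Sum>i\<in>X. i * R 0) - weight X s" arbitrary: s rule: less_induct)
    case less
    have fr: "fits X (boxes R) (column_rank X s) s" by (rule fits_column_rank[OF R X less.prems])
    show ?case
    proof (cases "standard X C s")
      case True
      then show ?thesis using odd weight_le[OF R fr] by (simp add: N_def)
    next
      case False
      then obtain i k where ik: "i \<in> X" "k \<in> X" "column_rank X s i = column_rank X s k" "s i < s k" "\<not> i < k"
        using less.prems unfolding standard_def by blast
      then have ki: "k < i" by (metis linorder_neqE_nat less_irrefl)
      define \<rho> where "\<rho> = column_rank X s i"
      \<comment> \<open>The Garnir set: \<open>A\<close> holds the letters of the left column from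
        \<open>i\<close> on, \<open>Y\<close> those of the right column up to \<open>k\<close>.
        Together they are one more than the left column has boxes, and \<open>k < i\<close> makes
        every letter of \<open>Y\<close> smaller than every letter of \<open>A\<close>.\<close>
      define A where "A = {x\<in>X. s x = s i \<and> i \<le> x}"
      define Y where "Y = {y\<in>X. s y = s k \<and> y \<le> k}"
      define Z where "Z = A \<union> Y"
      have fZ: "finite A" "finite Y" "finite Z" using X by (auto simp: A_def Y_def Z_def)
      have ZX: "Z \<subseteq> X" by (auto simp: Z_def A_def Y_def)
      have disj: "A \<inter> Y = {}" using ik by (auto simp: A_def Y_def)
      have rC: "\<rho> < C (s i)" "\<rho> < C (s k)"
        using fits_mem[OF fr, of i] fits_mem[OF fr, of k] ik conjugateD[OF R] by (auto simp: \<rho>_def boxes_def)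
      have "card {x\<in>X. s x = s i} = card {x\<in>X. s x = s i \<and> x < i} + card A"
      proof -
        have "{x\<in>X. s x = s i} = {x\<in>X. s x = s i \<and> x < i} \<union> A" by (auto simp: A_def)
        then show ?thesis using X fZ by (simp add: card_Un_disjoint A_def disjoint_iff)
      qed
      then have cA: "\<rho> + card A = C (s i)"
        using less.prems by (simp add: has_content_def \<rho>_def column_rank_def)
      have "Y = insert k {x\<in>X. s x = s k \<and> x < k}" using ik by (auto simp: Y_def)
      then have cY: "card Y = Suc \<rho>" using X ik by (simp add: \<rho>_def column_rank_def)
      have cZ: "card Z = Suc (C (s i))" using cA cY fZ disj by (simp add: Z_def card_Un_disjoint)
      define F where "F = {B. B \<subseteq> Z \<and> card B = Suc \<rho>}"
      have fF: "finite F" unfolding F_def by (rule finite_subset[of _ "Pow Z"]) (use fZ in auto)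
      have YF: "Y \<in> F" using cY by (simp add: F_def Z_def)
      have sZ: "s z = (if z \<in> Y then s k else s i)" if "z \<in> Z" for z
        using that disj by (auto simp: Z_def A_def Y_def)
      let ?s = "recolour Z (s i) (s k) s"
      have eF: "even (card F)"
      proof -
        \<comment> \<open>The two columns may be far apart, but the right one is at most as long as
          column \<open>Suc (s i)\<close>, so \<open>garnir\<close> covers the coefficient.\<close>
        have "C (s k) \<le> C (Suc (s i))" using conjugate_antimono[OF conjugate_sym[OF R]] ik(4) by simp
        then have "even (Suc (C (s i)) choose Suc \<rho>)" using g rC unfolding garnir_def
          by (metis One_nat_def Suc_leI Suc_le_mono le0 le_trans)
        then show ?thesis using n_subsets[OF fZ(3), of "Suc \<rho>"] cZ by (simp add: F_def)
      qed
      have "(\<Sum>B\<in>F. card {w\<in>\<D>. ?f w (?s B)}) = (\<Sum>w\<in>\<D>. card {B\<in>F. ?f w (?s B)})"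
        by (rule sum_card_swap[OF fF fin])
      moreover have "even (card {B\<in>F. ?f w (?s B)})" for w
        using even_card_column_exchange[OF R X ZX, of "s i" "s k" "Suc \<rho>" w s] cZ ik(4)
        by (simp add: F_def conj_assoc)
      ultimately have e: "even (\<Sum>B\<in>F. card {w\<in>\<D>. ?f w (?s B)})" by (simp add: dvd_sum)
      have o: "odd (card {w\<in>\<D>. ?f w (?s B)})" if B: "B \<in> F" "B \<noteq> Y" for B
      proof (rule less.hyps)
        have BZ: "B \<subseteq> Z" "card B = card Y" using B cY by (auto simp: F_def)
        have Yq: "{z\<in>Z. s z = s k} = Y" using ik(4) by (auto simp: Z_def A_def Y_def)
        show c: "has_content X (?s B) C"
          by (rule has_content_recolour[OF X ZX less.prems]) (use sZ ik BZ Yq in auto)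
        have "weight X s < weight X (?s B)"
          by (rule weight_recolour_less[OF X ZX sZ ik(4) _ BZ B(2)])
            (use ki in \<open>auto simp: Z_def A_def Y_def\<close>)
        moreover have "weight X (?s B) \<le> (\<Sum>i\<in>X. i * R 0)"
          using weight_le[OF conjugate_sym[OF R]] fits_column_rank[OF R X c] fits_sym[OF R] by blast
        ultimately show "(\<Sum>i\<in>X. i * R 0) - weight X (?s B) < (\<Sum>i\<in>X. i * R 0) - weight X s" by simp
      qed
      have "?s Y = s" using sZ by (auto simp: recolour_def fun_eq_iff)
      moreover have "odd (card {w\<in>\<D>. ?f w (?s Y)})"
      proof (rule ccontr)
        assume "\<not> ?thesis"
        \<comment> \<open>If the count for \<open>Y\<close> were even, the sets with odd counts
          would be all of \<open>F\<close> except \<open>Y\<close>. Their number is even by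
          \<open>e\<close>, whereas \<open>F\<close> itself has even size.\<close>
        then have "{B\<in>F. odd (card {w\<in>\<D>. ?f w (?s B)})} = F - {Y}" using o by auto
        then have "even (card (F - {Y}))" using e fF by (simp add: even_sum_iff)
        then show False using eF YF fF by (metis card_Suc_Diff1 even_Suc)
      qed
      ultimately show ?thesis by simp
    qed
  qed
  moreover have "has_content X w R" if "w \<in> \<D>" for w using D[OF that] content_row_fits by blast
  ultimately show ?thesis using fin by blast
qed

section \<open>Combinations equal to the sum of all tabloids\<close>

lemma of_nat_char_2:
  assumes "CHAR('a::field) = 2"
  shows "of_nat m = (of_bool (odd m) :: 'a)"
proof -
  have "of_nat 2 = (0 :: 'a)" by (simp only: of_nat_eq_0_iff_char_dvd assms) simp
  then have *: "of_nat (2 * k) = (0 :: 'a)" for k by (simp only: of_nat_mult mult_zero_left)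
  show ?thesis by (cases "even m") (use * in \<open>auto elim!: evenE oddE\<close>)
qed

text \<open>The sum over \<open>k\<close> is the coefficient at the tabloid of \<open>w\<close>, so
  the condition says that the polytabloids of the \<open>s k\<close> with coefficients
  \<open>c k\<close> add up to \<Omega>, the sum of all tabloids.\<close>

definition uniform_combination ::
    "'i set \<Rightarrow> (nat \<Rightarrow> nat) \<Rightarrow> (nat \<Rightarrow> nat) \<Rightarrow> 'k set \<Rightarrow> ('k \<Rightarrow> 'a::field) \<Rightarrow> ('k \<Rightarrow> 'i \<Rightarrow> nat) \<Rightarrow> bool" where
  "uniform_combination X R C K c s \<longleftrightarrow> finite K \<and> (\<forall>k\<in>K. has_content X (s k) C) \<and>
     (\<forall>w. has_content X w R \<longrightarrow> (\<Sum>k\<in>K. c k * of_bool (fits X (boxes R) w (s k))) = 1)"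

lemma sum_of_bool_swap:
  assumes "finite A"
  shows "(\<Sum>a\<in>A. \<Sum>k\<in>K. c k * of_bool (P a k)) = (\<Sum>k\<in>K. (c k :: 'a::field) * of_nat (card {a\<in>A. P a k}))"
proof -
  have "(\<Sum>a\<in>A. \<Sum>k\<in>K. c k * of_bool (P a k)) = (\<Sum>k\<in>K. c k * (\<Sum>a\<in>A. of_bool (P a k)))"
    by (subst sum.swap) (simp add: sum_distrib_left)
  moreover have "(\<Sum>a\<in>A. of_bool (P a k)) = (of_nat (card {a\<in>A. P a k}) :: 'a)" for k
    using assms by (simp add: sum.If_cases of_bool_def Int_def)
  ultimately show ?thesis by simp
qed

text \<open>These relations hold for every linear combination of polytabloids. They are the
  vanishing conditions of James's kernel intersection theorem: \<open>Y\<close> is kept in row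
  \<open>Suc r\<close>, and the rest of that row varies within the letters of the two rows.\<close>

lemma row_relation:
  assumes char: "CHAR('a::field) = 2" and R: "conjugate R C" and X: "finite X"
    and Z: "Z = {i\<in>X. w i \<in> {r, Suc r}}" and Y: "Y \<subseteq> Z" "card Y < R (Suc r)"
  shows "(\<Sum>B | Y \<subseteq> B \<and> B \<subseteq> Z \<and> card B = R (Suc r).
    \<Sum>k\<in>K. (c k :: 'a) * of_bool (fits X (boxes R) (recolour Z r (Suc r) w B) (s k))) = 0"
proof -
  define F where "F = {B. Y \<subseteq> B \<and> B \<subseteq> Z \<and> card B = R (Suc r)}"
  have ZX: "Z \<subseteq> X" "finite Z" using X by (auto simp: Z)
  have fF: "finite F" unfolding F_def by (rule finite_subset[of _ "Pow Z"]) (use ZX in auto)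
  let ?w = "recolour Z r (Suc r) w"
  have "(\<Sum>B\<in>F. \<Sum>k\<in>K. c k * of_bool (fits X (boxes R) (?w B) (s k))) =
      (\<Sum>k\<in>K. c k * of_nat (card {B\<in>F. fits X (boxes R) (?w B) (s k)}))"
    by (rule sum_of_bool_swap[OF fF])
  also have "\<dots> = 0"
  proof (rule sum.neutral, rule ballI)
    fix k
    have "even (card {B. Y \<subseteq> B \<and> B \<subseteq> Z \<and> card B = R (Suc r) \<and> fits X (boxes R) (?w B) (s k)})"
      by (rule even_card_row_exchange[OF R X ZX(1)]) (use Y in \<open>auto simp: Z\<close>)
    then have "even (card {B\<in>F. fits X (boxes R) (?w B) (s k)})" by (simp add: F_def conj_assoc)
    then show "c k * of_nat (card {B\<in>F. fits X (boxes R) (?w B) (s k)}) = 0" by (simp add: of_nat_char_2[OF char])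
  qed
  finally show ?thesis by (simp only: F_def)
qed

text \<open>All coefficients of \<Omega> are 1, so a row relation just counts its terms. With
  \<open>R (Suc r) - v\<close> letters fixed in row \<open>Suc r\<close>, the other \<open>v\<close>
  are chosen from \<open>R r + v\<close> letters.\<close>

lemma row_condition:
  assumes char: "CHAR('a::field) = 2" and R: "conjugate R C" and X: "finite X"
    and u: "uniform_combination X R C K (c :: 'k \<Rightarrow> 'a) s" and w: "has_content X w R"
    and v: "1 \<le> v" "v \<le> R (Suc r)"
  shows "even ((R r + v) choose v)"
proof -
  define Z where "Z = {i\<in>X. w i \<in> {r, Suc r}}"
  have ZX: "Z \<subseteq> X" "finite Z" using X by (auto simp: Z_def)
  have "Z = {i\<in>X. w i = r} \<union> {i\<in>X. w i = Suc r}" by (auto simp: Z_def)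
  then have "card Z = card {i\<in>X. w i = r} + card {i\<in>X. w i = Suc r}"
    using X by (simp add: card_Un_disjoint disjoint_iff)
  then have cZ: "card Z = R r + R (Suc r)" using w by (simp add: has_content_def)
  then have "R (Suc r) - v \<le> card Z" by simp
  then obtain Y where Y: "Y \<subseteq> Z" "card Y = R (Suc r) - v"
    by (rule obtain_subset_with_card_n)
  define F where "F = {B. Y \<subseteq> B \<and> B \<subseteq> Z \<and> card B = R (Suc r)}"
  have "{z\<in>Z. w z = Suc r} = {i\<in>X. w i = Suc r}" by (auto simp: Z_def)
  then have cq: "card {z\<in>Z. w z = Suc r} = R (Suc r)" using w by (simp add: has_content_def)
  let ?w = "recolour Z r (Suc r) w"
  have "has_content X (?w B) R" if "B \<in> F" for B
    by (rule has_content_recolour[OF X ZX(1) w]) (use that cq in \<open>auto simp: F_def Z_def\<close>)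
  then have "(\<Sum>k\<in>K. c k * of_bool (fits X (boxes R) (?w B) (s k))) = 1" if "B \<in> F" for B
    using u that unfolding uniform_combination_def by blast
  then have "of_nat (card F) = (\<Sum>B\<in>F. \<Sum>k\<in>K. c k * of_bool (fits X (boxes R) (?w B) (s k)))"
    by simp
  also have "\<dots> = 0" unfolding F_def by (rule row_relation[OF char R X Z_def Y(1)]) (use Y v in simp)
  finally have "even (card F)" by (auto simp: of_nat_char_2[OF char])
  moreover have "card F = (R r + v) choose v"
    using card_between[OF ZX(2) Y(1), of "R (Suc r)"] Y(2) cZ v by (simp add: F_def)
  ultimately show ?thesis by simp
qed

text \<open>The hypothesis \<open>rel\<close> says that every vanishing sum of polytabloids has an
  even number of terms. It is applied to the Garnir relations on neighbouring columns.\<close>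

lemma garnir_if_relations_even:
  assumes R: "conjugate R C" and X: "finite X" and s: "has_content X s C"
    and rel: "\<And>F (t :: 'i set \<Rightarrow> 'i \<Rightarrow> nat). finite F \<Longrightarrow> (\<And>B. B \<in> F \<Longrightarrow> has_content X (t B) C) \<Longrightarrow>
      (\<And>w. even (card {B\<in>F. fits X (boxes R) w (t B)})) \<Longrightarrow> even (card F)"
  shows "garnir C"
  unfolding garnir_def
proof (intro allI impI)
  fix j i assume i: "1 \<le> i" "i \<le> C (Suc j)"
  have CC: "C (Suc j) \<le> C j" using conjugate_antimono[OF conjugate_sym[OF R]] by simp
  have c: "card {x\<in>X. s x = j} = C j" for j using s by (simp add: has_content_def)
  \<comment> \<open>Taking \<open>Suc (C j) - i\<close> letters of column \<open>j\<close> and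
    \<open>i\<close> letters of column \<open>Suc j\<close> gives exactly one letter more than
    column \<open>j\<close> has boxes.\<close>
  have "Suc (C j) - i \<le> card {x\<in>X. s x = j}" using c i by simp
  then obtain A where A: "A \<subseteq> {x\<in>X. s x = j}" "card A = Suc (C j) - i"
    by (rule obtain_subset_with_card_n)
  have "i \<le> card {x\<in>X. s x = Suc j}" using c i by simp
  then obtain Y where Y: "Y \<subseteq> {x\<in>X. s x = Suc j}" "card Y = i"
    by (rule obtain_subset_with_card_n)
  define Z where "Z = A \<union> Y"
  have ZX: "Z \<subseteq> X" using A Y by (auto simp: Z_def)
  have fin: "finite A" "finite Y" "finite Z" using ZX X finite_subset by (auto simp: Z_def)
  have "{x\<in>X. s x = j} \<inter> {x\<in>X. s x = Suc j} = {}" by auto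
  then have "A \<inter> Y = {}" using A(1) Y(1) by blast
  then have cZ: "card Z = Suc (C j)" using A Y fin i CC by (simp add: Z_def card_Un_disjoint)
  have Yq: "{z\<in>Z. s z = Suc j} = Y" using A Y by (auto simp: Z_def)
  define F where "F = {B. B \<subseteq> Z \<and> card B = i}"
  have fF: "finite F" unfolding F_def by (rule finite_subset[of _ "Pow Z"]) (use fin in auto)
  have "even (card F)"
  proof (rule rel[OF fF, of "recolour Z j (Suc j) s"])
    show "has_content X (recolour Z j (Suc j) s B) C" if "B \<in> F" for B
      by (rule has_content_recolour[OF X ZX s]) (use that Yq A Y in \<open>auto simp: F_def Z_def\<close>)
    show "even (card {B\<in>F. fits X (boxes R) w (recolour Z j (Suc j) s B)})" for w
      using even_card_column_exchange[OF R X ZX, of j "Suc j" i w s] cZ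
      by (simp add: F_def conj_assoc)
  qed
  then show "even (Suc (C j) choose i)" using n_subsets[OF fin(3), of i] cZ by (simp add: F_def)
qed

section \<open>Adding two boxes to the first row\<close>

lemma fits_extend_first_row:
  assumes R: "conjugate R C" and P: "P \<subseteq> X'" and e: "bij_betw e P {R 0, Suc (R 0)}"
    and h: "bij_betw h (X' - P) X" and v: "\<And>x. x \<in> P \<Longrightarrow> v x = 0"
    and w: "\<And>x. x \<in> X' - P \<Longrightarrow> w (h x) = v x"
  shows "fits X' (boxes (R(0 := R 0 + 2))) v (\<lambda>x. if x \<in> P then e x else s (h x)) \<longleftrightarrow> fits X (boxes R) w s"
proof -
  let ?f = "\<lambda>x. (v x, if x \<in> P then e x else s (h x))"
  let ?B = "{(0, R 0), (0, Suc (R 0))}"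
  have b: "boxes (R(0 := R 0 + 2)) = boxes R \<union> ?B" "boxes R \<inter> ?B = {}"
    by (auto simp: boxes_def split: if_splits)
  have "bij_betw (\<lambda>j. (0::nat, j)) {R 0, Suc (R 0)} ?B" by (auto simp: bij_betw_def inj_on_def)
  from bij_betw_trans[OF e this] have "bij_betw ((\<lambda>j. (0::nat, j)) \<circ> e) P ?B" .
  then have fP: "bij_betw ?f P ?B" by (subst bij_betw_cong[of P _ "(\<lambda>j. (0::nat, j)) \<circ> e"]) (use v in auto)
  have "bij_betw ?f X' (boxes R \<union> ?B) \<longleftrightarrow> bij_betw ?f (X' - P) (boxes R)"
  proof
    assume "bij_betw ?f X' (boxes R \<union> ?B)"
    then have "bij_betw ?f (X' - P) ((boxes R \<union> ?B) - ?B)" by (rule bij_betw_DiffI[OF _ fP P]) simp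
    moreover have "(boxes R \<union> ?B) - ?B = boxes R" using b by blast
    ultimately show "bij_betw ?f (X' - P) (boxes R)" by simp
  next
    assume "bij_betw ?f (X' - P) (boxes R)"
    then have "bij_betw ?f ((X' - P) \<union> P) (boxes R \<union> ?B)" by (rule bij_betw_combine[OF _ fP b(2)])
    moreover have "(X' - P) \<union> P = X'" using P by auto
    ultimately show "bij_betw ?f X' (boxes R \<union> ?B)" by simp
  qed
  also have "\<dots> \<longleftrightarrow> bij_betw ((\<lambda>y. (w y, s y)) \<circ> h) (X' - P) (boxes R)"
    by (rule bij_betw_cong) (use w in auto)
  also have "\<dots> \<longleftrightarrow> bij_betw (\<lambda>y. (w y, s y)) X (boxes R)"
    by (rule bij_betw_comp_iff[symmetric, OF h])
  finally show ?thesis by (simp only: fits_def b(1))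
qed

lemma card_bij_fibre:
  assumes "bij_betw h A B" and "\<And>x. x \<in> A \<Longrightarrow> w (h x) = v x"
  shows "card {x\<in>A. v x = r} = card {y\<in>B. w y = r}"
proof (rule bij_betw_same_card[of h])
  show "bij_betw h {x\<in>A. v x = r} {y\<in>B. w y = r}"
    using assms by (auto simp: bij_betw_def inj_on_def image_iff)
qed

text \<open>The letters of \<open>P\<close> are put into two new columns of length 1, which turns
  the combination into the sum of all tabloids with \<open>P\<close> in the first row. The
  functional given by \<D> takes the value 1 on each extended polytabloid, hence the sum of the
  \<open>c k\<close> on the combination; on the tabloids it counts the words of \<D> with
  \<open>P\<close> in the first row.\<close>

lemma sum_eq_card_extended_family:
  assumes char: "CHAR('a::field) = 2" and R: "conjugate R C" and X: "finite X"
    and u: "uniform_combination X R C K (c :: 'k \<Rightarrow> 'a) s" and R0: "0 < R 0"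
    and X': "finite (X' :: 'i set)" and P: "P \<subseteq> X'" "card P = 2" and n: "card X' = card X + 2"
    and C': "\<And>j. C' j = (if j < R 0 then C j else of_bool (j < R 0 + 2))"
    and D: "finite \<D>" "\<And>v. v \<in> \<D> \<Longrightarrow> has_content X' v (R(0 := R 0 + 2))"
      "\<And>t. has_content X' t C' \<Longrightarrow> odd (card {v\<in>\<D>. fits X' (boxes (R(0 := R 0 + 2))) v t})"
  shows "(\<Sum>k\<in>K. c k) = of_nat (card {v\<in>\<D>. \<forall>x\<in>P. v x = 0})"
proof -
  let ?R' = "R(0 := R 0 + 2)"
  have fP: "finite P" using P X' finite_subset by blast
  then obtain e where e: "bij_betw e P {R 0, Suc (R 0)}"
    using finite_same_card_bij[of P "{R 0, Suc (R 0)}"] P by auto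
  have "card (X' - P) = card X" using P fP n by (simp add: card_Diff_subset)
  then obtain h where h: "bij_betw h (X' - P) X"
    using finite_same_card_bij[of "X' - P" X] X X' by auto
  define t where "t = (\<lambda>k x. if x \<in> P then e x else s k (h x))"
  have split: "card {x\<in>X'. v x = r} = card {x\<in>P. v x = r} + card {x\<in>X' - P. v x = r}" for v :: "'i \<Rightarrow> nat" and r
  proof -
    have "{x\<in>X'. v x = r} = {x\<in>P. v x = r} \<union> {x\<in>X' - P. v x = r}" using P by auto
    then show ?thesis using X' fP by (simp add: card_Un_disjoint disjoint_iff)
  qed
  have t: "has_content X' (t k) C'" if "k \<in> K" for k
    unfolding has_content_def
  proof
    fix j
    have C0: "C j = 0" if "R 0 \<le> j" using conjugateD[OF R, of j 0] that by simp
    have "{y\<in>{R 0, Suc (R 0)}. y = j} = (if j = R 0 \<or> j = Suc (R 0) then {j} else {})" by auto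
    then have "card {y\<in>{R 0, Suc (R 0)}. y = j} = (if j = R 0 \<or> j = Suc (R 0) then 1 else 0)" by simp
    moreover have "card {x\<in>P. t k x = j} = card {y\<in>{R 0, Suc (R 0)}. y = j}"
      by (rule card_bij_fibre[OF e]) (simp add: t_def)
    moreover have "card {x\<in>X' - P. t k x = j} = card {y\<in>X. s k y = j}"
      by (rule card_bij_fibre[OF h]) (simp add: t_def)
    moreover have "card {y\<in>X. s k y = j} = C j"
      using u that by (simp add: uniform_combination_def has_content_def)
    ultimately have "card {x\<in>X'. t k x = j} = (if j = R 0 \<or> j = Suc (R 0) then 1 else 0) + C j"
      using split[of "t k" j] by simp
    also have "\<dots> = C' j" unfolding C' using C0 by (cases "j < R 0") auto
    finally show "card {x\<in>X'. t k x = j} = C' j" .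
  qed
  have *: "(\<Sum>k\<in>K. c k * of_bool (fits X' (boxes ?R') v (t k))) = of_bool (\<forall>x\<in>P. v x = 0)"
    if v: "has_content X' v ?R'" for v
  proof (cases "\<forall>x\<in>P. v x = 0")
    case False
    then obtain x where x: "x \<in> P" "v x > 0" by auto
    \<comment> \<open>A letter of \<open>P\<close> lies in a column with index at least
      \<open>R 0\<close>, and no row below the first reaches that far.\<close>
    have "\<not> fits X' (boxes ?R') v (t k)" for k
    proof
      assume "fits X' (boxes ?R') v (t k)"
      moreover have "x \<in> X'" using x P by blast
      ultimately have "(v x, t k x) \<in> boxes ?R'" by (rule fits_mem)
      then have "e x < R (v x)" using x by (simp add: boxes_def t_def)
      moreover have "R (v x) \<le> R 0" by (rule conjugate_antimono[OF R]) simp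
      moreover have "e x \<ge> R 0" using bij_betwE[OF e] x by auto
      ultimately show False by simp
    qed
    then have "(\<Sum>k\<in>K. c k * of_bool (fits X' (boxes ?R') v (t k))) = 0" by simp
    then show ?thesis using False by (simp only: of_bool_eq)
  next
    case True
    \<comment> \<open>The word of the letters outside \<open>P\<close>, carried over to
      \<open>X\<close> along \<open>h\<close>.\<close>
    define w where "w y = v (inv_into (X' - P) h y)" for y
    have w: "w (h x) = v x" if "x \<in> X' - P" for x
      using h that by (simp add: w_def bij_betw_def inv_into_f_f)
    have "has_content X w R"
      unfolding has_content_def
    proof
      fix r
      have "card {x\<in>X' - P. v x = r} = card {y\<in>X. w y = r}" by (rule card_bij_fibre[OF h]) (rule w)
      moreover have "{x\<in>P. v x = r} = (if r = 0 then P else {})" using True by auto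
      ultimately show "card {y\<in>X. w y = r} = R r"
        using v split[of v r] P by (auto simp: has_content_def split: if_splits)
    qed
    then have "(\<Sum>k\<in>K. c k * of_bool (fits X (boxes R) w (s k))) = 1"
      using u unfolding uniform_combination_def by blast
    moreover have "fits X' (boxes ?R') v (t k) \<longleftrightarrow> fits X (boxes R) w (s k)" for k
      unfolding t_def by (rule fits_extend_first_row[OF R P(1) e h]) (use True w in auto)
    ultimately show ?thesis using True by simp
  qed
  have "(\<Sum>k\<in>K. c k) = (\<Sum>k\<in>K. c k * of_nat (card {v\<in>\<D>. fits X' (boxes ?R') v (t k)}))"
    by (rule sum.cong) (use D(3)[OF t] in \<open>auto simp: of_nat_char_2[OF char]\<close>)
  also have "\<dots> = (\<Sum>v\<in>\<D>. \<Sum>k\<in>K. c k * of_bool (fits X' (boxes ?R') v (t k)))"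
    by (rule sum_of_bool_swap[OF D(1), symmetric])
  also have "\<dots> = (\<Sum>v\<in>\<D>. of_bool (\<forall>x\<in>P. v x = 0))"
    by (rule sum.cong) (use * D(2) in auto)
  also have "\<dots> = of_nat (card {v\<in>\<D>. \<forall>x\<in>P. v x = 0})"
    using D(1) by (simp add: sum.If_cases of_bool_def Int_def)
  finally show ?thesis .
qed

text \<open>The sum of the \<open>c k\<close> is the same count for every pair of letters, so adding
  over all pairs multiplies it by an odd number. Counted by the words of \<D> instead, each word
  contributes the even number of pairs in its first row.\<close>

lemma sum_uniform_combination_eq_0:
  assumes char: "CHAR('a::field) = 2" and R: "conjugate R C" and X: "finite (X :: nat set)"
    and u: "uniform_combination X R C K (c :: 'k \<Rightarrow> 'a) s" and g: "garnir C"
    and odd: "\<And>j. j < R 0 \<Longrightarrow> odd (C j)" and a: "R 0 mod 4 = 3" and n: "card X mod 4 = 1"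
  shows "(\<Sum>k\<in>K. c k) = 0"
proof -
  let ?R' = "R(0 := R 0 + 2)"
  define C' where "C' j = (if j < R 0 then C j else of_bool (j < R 0 + 2))" for j
  have R0: "0 < R 0" using a by (cases "R 0") auto
  have R': "conjugate ?R' C'"
    unfolding conjugate_def
  proof (intro allI)
    fix r j
    have "R r \<le> R 0" by (rule conjugate_antimono[OF R]) simp
    moreover have "0 < C j" if "j < R 0" using conjugateD[OF R, of j 0] that by simp
    ultimately show "j < ?R' r \<longleftrightarrow> r < C' j"
      using conjugateD[OF R, of j r] by (auto simp: C'_def)
  qed
  \<comment> \<open>New conditions arise only where the next column has length 1. There
    \<open>i = 1\<close>, and odd column lengths suffice.\<close>
  have g': "garnir C'"
    unfolding garnir_def
  proof (intro allI impI)
    fix j i assume i: "1 \<le> i" "i \<le> C' (Suc j)"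
    show "even (Suc (C' j) choose i)"
    proof (cases "Suc j < R 0")
      case True
      then show ?thesis using i g by (simp add: C'_def garnir_def)
    next
      case False
      then have "i = 1" "j < R 0 + 2" using i by (auto simp: C'_def of_bool_def split: if_splits)
      then show ?thesis using odd[of j] by (simp add: C'_def)
    qed
  qed
  obtain P0 :: "nat set" where P0: "finite P0" "card P0 = 2" "P0 \<inter> X = {}"
  proof -
    have "infinite (UNIV - X)" using X by (simp add: Diff_infinite_finite)
    then obtain T where "T \<subseteq> UNIV - X" "finite T" "card T = 2"
      using infinite_arbitrarily_large by metis
    then show ?thesis using that[of T] by blast
  qed
  define X' where "X' = X \<union> P0"
  have X': "finite X'" "card X' = card X + 2"
    using X P0 by (auto simp: X'_def card_Un_disjoint Int_commute)
  obtain \<D> where D: "finite \<D>" "\<And>v. v \<in> \<D> \<Longrightarrow> has_content X' v ?R'"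
      "\<And>t. has_content X' t C' \<Longrightarrow> odd (card {v\<in>\<D>. fits X' (boxes ?R') v t})"
    using exists_odd_family[OF R' X'(1) g'] by blast
  define \<P> where "\<P> = {P. P \<subseteq> X' \<and> card P = 2}"
  have fP: "finite \<P>" unfolding \<P>_def by (rule finite_subset[of _ "Pow X'"]) (use X' in auto)
  have "(\<Sum>k\<in>K. c k) = of_nat (card {v\<in>\<D>. \<forall>x\<in>P. v x = 0})" if "P \<in> \<P>" for P
    by (rule sum_eq_card_extended_family[OF char R X u R0 X'(1) _ _ X'(2) C'_def D])
      (use that in \<open>auto simp: \<P>_def\<close>)
  then have "of_nat (card \<P>) * (\<Sum>k\<in>K. c k) = (\<Sum>P\<in>\<P>. of_nat (card {v\<in>\<D>. \<forall>x\<in>P. v x = 0}))"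
    by (metis (no_types, lifting) sum.cong sum_constant)
  also have "\<dots> = of_nat (\<Sum>v\<in>\<D>. card {P\<in>\<P>. \<forall>x\<in>P. v x = 0})"
    by (simp only: of_nat_sum[symmetric] sum_card_swap[OF fP D(1)])
  also have "\<dots> = 0"
  proof -
    have "even (card {P\<in>\<P>. \<forall>x\<in>P. v x = 0})" if "v \<in> \<D>" for v
    proof -
      have "{P\<in>\<P>. \<forall>x\<in>P. v x = 0} = {P. P \<subseteq> {x\<in>X'. v x = 0} \<and> card P = 2}" by (auto simp: \<P>_def)
      then have "card {P\<in>\<P>. \<forall>x\<in>P. v x = 0} = (R 0 + 2) choose 2"
        using n_subsets[of "{x\<in>X'. v x = 0}" 2] X' D(2)[OF that] by (simp add: has_content_def)
      moreover have "even ((R 0 + 2) choose 2)"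
      proof -
        obtain q where "R 0 = 4 * q + 3" using a by (metis mult_div_mod_eq)
        then have "(R 0 + 2) choose 2 = (4 * q + 5) * (2 * (2 * q + 2)) div 2" by (simp add: choose_two algebra_simps)
        also have "\<dots> = (4 * q + 5) * (2 * q + 2)" by simp
        finally show ?thesis by simp
      qed
      ultimately show ?thesis by simp
    qed
    then have "even (\<Sum>v\<in>\<D>. card {P\<in>\<P>. \<forall>x\<in>P. v x = 0})" by (rule dvd_sum)
    then show ?thesis by (simp add: of_nat_char_2[OF char])
  qed
  finally have "of_nat (card \<P>) * (\<Sum>k\<in>K. c k) = 0" .
  moreover have "odd (card \<P>)"
  proof -
    obtain q where "card X = 4 * q + 1" using n by (metis mult_div_mod_eq)
    then have "card X' choose 2 = (4 * q + 3) * (2 * (2 * q + 1)) div 2" using X' by (simp add: choose_two algebra_simps)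
    also have "\<dots> = (4 * q + 3) * (2 * q + 1)" by simp
    finally show ?thesis using n_subsets[OF X'(1), of 2] by (simp add: \<P>_def)
  qed
  ultimately show ?thesis by (simp add: of_nat_char_2[OF char])
qed

section \<open>Filling the missing corner of a rectangle\<close>

lemma has_content_remove:
  assumes "finite X" "z \<notin> X" "has_content (insert z X) w R"
  shows "has_content X w (R(w z := R (w z) - 1))"
  unfolding has_content_def
proof
  fix r
  have "card {i \<in> insert z X. w i = r} = R r" using assms(3) by (simp add: has_content_def)
  moreover have "{i \<in> insert z X. w i = r} = (if w z = r then insert z {i\<in>X. w i = r} else {i\<in>X. w i = r})" by auto
  ultimately show "card {i \<in> X. w i = r} = (R(w z := R (w z) - 1)) r" using assms(1,2) by (auto split: if_splits)
qed

lemma has_content_insert: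
  assumes "finite X" "z \<notin> X" "has_content X w R" "\<And>r. R' r = R r + of_bool (r = j)"
  shows "has_content (insert z X) (w(z := j)) R'"
  unfolding has_content_def
proof
  fix r
  have "{i \<in> insert z X. (w(z := j)) i = r} = (if r = j then insert z {i\<in>X. w i = r} else {i\<in>X. w i = r})"
    using assms(2) by auto
  then show "card {i \<in> insert z X. (w(z := j)) i = r} = R' r"
    using assms by (simp add: has_content_def)
qed

lemma fits_insert:
  assumes "z \<notin> X" "b \<notin> D" "(w z, j) = b"
  shows "fits (insert z X) (insert b D) w (s(z := j)) \<longleftrightarrow> fits X D w s"
proof -
  let ?f = "\<lambda>i. (w i, (s(z := j)) i)"
  have "?f z = b" using assms by simp
  then have "bij_betw ?f (insert z X) (insert b D) \<longleftrightarrow> bij_betw ?f X D"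
    using notIn_Un_bij_betw3[of z X ?f D] assms by simp
  also have "\<dots> \<longleftrightarrow> bij_betw (\<lambda>i. (w i, s i)) X D"
    by (rule bij_betw_cong) (use assms in auto)
  finally show ?thesis by (simp add: fits_def)
qed

text \<open>
  In an element of the Specht module of a rectangle, the coefficients of the tabloids with \<open>z\<close> in
  the last row determine all others: the row relations, summed over all sets \<open>Y\<close> of the other
  entries of the row of \<open>z\<close>, isolate one coefficient, because a tabloid whose lower row contains
  \<open>m\<close> of these entries is counted \<open>2 ^ m\<close> times.
\<close>

lemma uniform_combination_rectangle:
  assumes char: "CHAR('a::field) = 2" and X: "finite X" "z \<notin> X"
    and al: "0 < a" "0 < l"
    and R: "\<And>r. R r = (if r < l then a else 0) - of_bool (r = l - 1)"
    and C: "\<And>j. C j = (if j < a then l else 0) - of_bool (j = a - 1)"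
    and u: "uniform_combination X R C K (c :: 'k \<Rightarrow> 'a) s"
    and even: "\<And>v. 1 \<le> v \<Longrightarrow> v \<le> a \<Longrightarrow> even ((a + v) choose v)"
  shows "uniform_combination (insert z X) (\<lambda>r. if r < l then a else 0) (\<lambda>j. if j < a then l else 0)
    K c (\<lambda>k. (s k)(z := a - 1))"
proof -
  let ?R = "\<lambda>r. if r < l then a else 0" and ?C = "\<lambda>j. if j < a then l else 0"
  let ?X = "insert z X" and ?s = "\<lambda>k. (s k)(z := a - 1)"
  let ?S = "\<lambda>w. \<Sum>k\<in>K. c k * of_bool (fits ?X (boxes ?R) w (?s k))"
  have fX: "finite ?X" using X by simp
  have conj: "conjugate ?R ?C" by (auto simp: conjugate_def)
  \<comment> \<open>Induction on the distance \<open>d\<close> between the row of \<open>z\<close>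
    and the last row.\<close>
  have "?S w = 1" if "has_content ?X w ?R" "w z = l - 1 - d" "d < l" for w d
    using that
  proof (induction d arbitrary: w)
    case 0
    \<comment> \<open>With \<open>z\<close> in the last row, the other letters form a word of the
      truncated shape, and \<open>z\<close> takes the corner box.\<close>
    have b: "boxes ?R = insert (l - 1, a - 1) (boxes R)" "(l - 1, a - 1) \<notin> boxes R"
      using al by (auto simp: boxes_def R of_bool_def split: if_splits)
    have "?R(w z := ?R (w z) - 1) = R" using 0 by (auto simp: R fun_eq_iff)
    then have "has_content X w R" using has_content_remove[OF X 0(1)] by simp
    then have "(\<Sum>k\<in>K. c k * of_bool (fits X (boxes R) w (s k))) = 1"
      using u unfolding uniform_combination_def by blast
    moreover have "fits ?X (boxes ?R) w (?s k) \<longleftrightarrow> fits X (boxes R) w (s k)" for k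
      unfolding b(1) by (rule fits_insert[OF X(2) b(2)]) (use 0 in simp)
    ultimately show ?case by (simp only:)
  next
    case (Suc d)
    define r where "r = l - 1 - Suc d"
    have r: "Suc r < l" "Suc r = l - 1 - d" "w z = r" using Suc.prems by (auto simp: r_def)
    define Z where "Z = {i\<in>?X. w i \<in> {r, Suc r}}"
    \<comment> \<open>The other letters in the row of \<open>z\<close>. There are fewer than
      \<open>a\<close> of them, so each subset is admissible as \<open>Y\<close> in a row
      relation.\<close>
    define A where "A = {i\<in>?X. w i = r} - {z}"
    define B0 where "B0 = {i\<in>?X. w i = Suc r}"
    have c: "card {i\<in>?X. w i = q} = ?R q" for q using Suc.prems by (simp add: has_content_def)
    have fin: "finite Z" "finite A" "finite B0" using X by (auto simp: Z_def A_def B0_def)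
    have ZX: "Z \<subseteq> ?X" by (auto simp: Z_def)
    have cA: "card A < a" using c[of r] r al X by (simp add: A_def)
    have cB: "card B0 = a" using c[of "Suc r"] r by (simp add: B0_def)
    have "Z = insert z A \<union> B0" "insert z A \<inter> B0 = {}" using r by (auto simp: Z_def A_def B0_def)
    moreover have "card (insert z A) = a"
    proof -
      have "insert z A = {i\<in>?X. w i = r}" using r by (auto simp: A_def)
      then show ?thesis using c[of r] r by simp
    qed
    ultimately have cZ: "card Z = 2 * a"
      using cB fin card_Un_disjoint[of "insert z A" B0] by (simp del: Un_insert_left)
    have "A \<subseteq> Z" by (auto simp: A_def Z_def)
    let ?w = "recolour Z r (Suc r) w"
    define F where "F = {B. B \<subseteq> Z \<and> card B = a}"
    have fF: "finite F" unfolding F_def by (rule finite_subset[of _ "Pow Z"]) (use fin in auto)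
    \<comment> \<open>The deviation from the expected value 1. Each row relation below has an even
      number of terms, so subtracting 1 from each term preserves it in characteristic 2.\<close>
    define f where "f B = ?S (?w B) - 1" for B
    have "(\<Sum>B | B \<in> F \<and> Y \<subseteq> B. f B) = 0" if Y: "Y \<in> Pow A" for Y
    proof -
      have F: "{B. B \<in> F \<and> Y \<subseteq> B} = {B. Y \<subseteq> B \<and> B \<subseteq> Z \<and> card B = ?R (Suc r)}"
        using r by (auto simp: F_def)
      have YZ: "Y \<subseteq> Z" using Y \<open>A \<subseteq> Z\<close> by auto
      have "card Y \<le> card A" using Y fin by (simp add: card_mono)
      then have cY: "card Y < ?R (Suc r)" using cA r by simp
      have "card {B. B \<in> F \<and> Y \<subseteq> B} = (card Z - card Y) choose (a - card Y)"
        unfolding F using card_between[OF fin(1) YZ, of "?R (Suc r)"] cY r by simp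
      also have "card Z - card Y = a + (a - card Y)" using cZ cY r by simp
      finally have "even (card {B. B \<in> F \<and> Y \<subseteq> B})" using even[of "a - card Y"] cY r by simp
      moreover have "(\<Sum>B | B \<in> F \<and> Y \<subseteq> B. ?S (?w B)) = 0"
        unfolding F by (rule row_relation[OF char conj fX Z_def YZ cY])
      ultimately show ?thesis by (simp add: f_def sum_subtractf of_nat_char_2[OF char])
    qed
    then have "(\<Sum>Y\<in>Pow A. \<Sum>B | B \<in> F \<and> Y \<subseteq> B. f B) = 0" by (intro sum.neutral) blast
    moreover have "(\<Sum>Y\<in>Pow A. \<Sum>B | B \<in> F \<and> Y \<subseteq> B. f B) = (\<Sum>B\<in>F. \<Sum>Y | Y \<in> Pow A \<and> Y \<subseteq> B. f B)"
      by (rule sum.swap_restrict) (use fin fF in auto)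
    moreover have "(\<Sum>Y | Y \<in> Pow A \<and> Y \<subseteq> B. f B) = (if B = B0 then f B else 0)" if B: "B \<in> F" for B
    proof -
      have "{Y. Y \<in> Pow A \<and> Y \<subseteq> B} = Pow (A \<inter> B)" by auto
      then have s: "(\<Sum>Y | Y \<in> Pow A \<and> Y \<subseteq> B. f B) = of_nat (2 ^ card (A \<inter> B)) * f B"
        using fin by (simp only: sum_constant card_Pow finite_Int simp_thms)
      \<comment> \<open>If \<open>B\<close> meets \<open>A\<close>, the multiplicity is an even
        power of two. If \<open>B\<close> avoids \<open>A\<close> and contains \<open>z\<close>,
        then \<open>z\<close> has moved one row down and the deviation vanishes by induction. The
        only set left is \<open>B0\<close>, which reproduces \<open>w\<close>.\<close>
      consider "A \<inter> B \<noteq> {}" | "A \<inter> B = {}" "z \<in> B" | "A \<inter> B = {}" "z \<notin> B" by blast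
      then show ?thesis
      proof cases
        case 1
        then have "card (A \<inter> B) > 0" using fin by (simp add: card_gt_0_iff)
        moreover have "B \<noteq> B0" using 1 by (auto simp: A_def B0_def)
        ultimately show ?thesis unfolding s by (simp add: of_nat_char_2[OF char] del: of_nat_power)
      next
        case 2
        have q: "{i\<in>Z. w i = Suc r} = B0" by (auto simp: Z_def B0_def)
        have "has_content ?X (?w B) ?R"
          by (rule has_content_recolour[OF fX ZX Suc.prems(1)])
            (use B cB q in \<open>auto simp: F_def Z_def\<close>)
        moreover have "?w B z = l - 1 - d" using 2 B r by (auto simp: recolour_def F_def)
        ultimately have "?S (?w B) = 1" using Suc.prems(3) by (intro Suc.IH) auto
        then have "f B = 0" by (simp only: f_def diff_self)
        moreover have "B \<noteq> B0" using 2 r by (auto simp: B0_def)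
        ultimately show ?thesis unfolding s by simp
      next
        case 3
        then have "B \<subseteq> B0" using B r by (auto simp: F_def Z_def A_def B0_def)
        then have "B = B0" using B cB fin by (simp add: F_def card_subset_eq)
        then show ?thesis unfolding s using 3 by simp
      qed
    qed
    ultimately have "(\<Sum>B\<in>F. if B = B0 then f B else 0) = 0" by simp
    moreover have "B0 \<in> F" using cB by (auto simp: F_def B0_def Z_def)
    ultimately have "f B0 = 0" using fF by simp
    moreover have "?w B0 = w" by (auto simp: recolour_def Z_def B0_def fun_eq_iff)
    ultimately show ?case by (simp only: f_def eq_iff_diff_eq_0[symmetric])
  qed
  moreover have "\<exists>d<l. w z = l - 1 - d" if "has_content ?X w ?R" for w
  proof -
    have "z \<in> {i\<in>?X. w i = w z}" by simp
    then have "card {i\<in>?X. w i = w z} > 0" using fX by (metis (no_types, lifting) card_gt_0_iff empty_iff finite_Collect_conjI finite_Collect_subsets finite_subset mem_Collect_eq subsetI)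
    then have "w z < l" using that by (simp add: has_content_def split: if_splits)
    then show ?thesis by (intro exI[of _ "l - 1 - w z"]) auto
  qed
  ultimately have "?S w = 1" if "has_content ?X w ?R" for w using that by blast
  moreover have "has_content ?X (?s k) ?C" if "k \<in> K" for k
    by (rule has_content_insert[OF X, of _ C]) (use u that al C in \<open>auto simp: uniform_combination_def\<close>)
  moreover have "finite K" using u by (simp add: uniform_combination_def)
  ultimately show ?thesis unfolding uniform_combination_def by blast
qed

section \<open>Shapes that satisfy the parity conditions\<close>

lemma mod_4_eq_3_if_choose_even:
  assumes "even (Suc p)" "even (Suc p choose 2)"
  shows "p mod 4 = 3"
proof -
  have "odd p" using assms(1) by simp
  then have "p mod 4 = 1 \<or> p mod 4 = 3" by presburger
  moreover have "p mod 4 \<noteq> 1"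
  proof
    assume "p mod 4 = 1"
    then obtain q where "p = 4 * q + 1" by (metis mult_div_mod_eq)
    then have "Suc p choose 2 = 2 * ((2 * q + 1) * (4 * q + 1)) div 2" by (simp add: choose_two algebra_simps)
    also have "\<dots> = (2 * q + 1) * (4 * q + 1)" by (rule nonzero_mult_div_cancel_left) simp
    finally show False using assms(2) by simp
  qed
  ultimately show ?thesis by blast
qed

text \<open>As no column has even length, rows \<open>2 * m + 1\<close> and \<open>2 * m + 2\<close>
  (counted from 0) are equally long. Their common length is odd, so each such pair adds 2 modulo 4
  to the 3 of the first row.\<close>

lemma sum_rows_mod_4:
  assumes R: "conjugate R C" and odd: "\<And>j. j < R 0 \<Longrightarrow> odd (C j)"
    and rows: "\<And>r. Suc r < C 0 \<Longrightarrow> odd (R r)" and R0: "R 0 mod 4 = 3"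
    and m: "2 * m < C 0"
  shows "(\<Sum>r<2 * m + 1. R r) mod 4 = (3 + 2 * m) mod 4"
  using m
proof (induction m)
  case (Suc m)
  have "R (2 * m + 2) = R (2 * m + 1)"
  proof (rule ccontr)
    assume "R (2 * m + 2) \<noteq> R (2 * m + 1)"
    then have lt: "R (2 * m + 2) < R (2 * m + 1)"
      using conjugate_antimono[OF R, of "2 * m + 1" "2 * m + 2"] by simp
    have "2 * m + 1 < C (R (2 * m + 2))" using conjugateD[OF R] lt by blast
    moreover have "\<not> 2 * m + 2 < C (R (2 * m + 2))" using conjugateD[OF R] by blast
    ultimately have "C (R (2 * m + 2)) = 2 * (m + 1)" by simp
    moreover have "R (2 * m + 2) < R 0" using lt conjugate_antimono[OF R, of 0 "2 * m + 1"] by simp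
    ultimately show False using odd by fastforce
  qed
  moreover have "odd (R (2 * m + 1))" using rows[of "2 * m + 1"] Suc.prems by simp
  then obtain q where "R (2 * m + 1) = 2 * q + 1" by (elim oddE)
  moreover define S where "S = (\<Sum>r<2 * m + 1. R r)"
  moreover have "(\<Sum>r<2 * Suc m + 1. R r) = S + R (2 * m + 1) + R (2 * m + 2)"
    unfolding S_def by simp
  ultimately have "(\<Sum>r<2 * Suc m + 1. R r) = S + 2 + 4 * q" by linarith
  moreover have lt: "2 * m < C 0" using Suc.prems by simp
  have IH: "S mod 4 = (3 + 2 * m) mod 4" unfolding S_def by (rule Suc.IH[OF lt])
  have "(S + 2 + 4 * q) mod 4 = (3 + 2 * Suc m) mod 4"
  proof -
    have "(S + 2 + 4 * q) mod 4 = (S + 2) mod 4" by (rule mod_mult_self2)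
    also have "\<dots> = (3 + 2 * m + 2) mod 4" using IH by (rule mod_add_cong) (rule refl)
    also have "3 + 2 * m + 2 = 3 + 2 * Suc m" by simp
    finally show ?thesis .
  qed
  ultimately show ?case by (simp only:)
qed (simp add: R0)

lemma card_eq_sum_rows:
  assumes "finite X" "has_content X w R" "\<And>r. l \<le> r \<Longrightarrow> R r = 0"
  shows "card X = (\<Sum>r<l. R r)"
proof -
  have "w ` X \<subseteq> {..<l}"
  proof
    fix r assume "r \<in> w ` X"
    then have "{i\<in>X. w i = r} \<noteq> {}" by auto
    moreover have "finite {i\<in>X. w i = r}" using assms(1) by simp
    ultimately have "R r \<noteq> 0" using assms(2) card_0_eq unfolding has_content_def by metis
    then show "r \<in> {..<l}" using assms(3) by (meson lessThan_iff not_less)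
  qed
  then have "card X = (\<Sum>r<l. card {i\<in>X. w i = r})"
    using sum.group[OF assms(1), of "{..<l}" w "\<lambda>_. 1::nat"] by simp
  then show ?thesis using assms(2) by (simp add: has_content_def)
qed

text \<open>By \<open>garnir\<close> with \<open>i = 1\<close> only the last column can have even
  length, and by \<open>rows\<close> only the last row can. If the last column is even, the row just
  below its end has \<open>R 0 - 1\<close> boxes; this number is even, so that row is the last
  one.\<close>

lemma rectangle_minus_corner:
  assumes R: "conjugate R C" and g: "garnir C" and rows: "\<And>r. Suc r < C 0 \<Longrightarrow> odd (R r)"
    and R1: "2 \<le> R 1" and R0: "odd (R 0)" and j: "j < R 0" "even (C j)"
  shows "R r = (if r < C 0 then R 0 else 0) - of_bool (r = C 0 - 1)"
    and "C i = (if i < R 0 then C 0 else 0) - of_bool (i = R 0 - 1)"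
proof -
  let ?a = "R 0" and ?l = "C 0"
  have a: "2 \<le> ?a" using R1 conjugate_antimono[OF R, of 0 1] by simp
  have ja: "Suc j = ?a"
  proof (rule ccontr)
    assume "Suc j \<noteq> ?a"
    then have "1 \<le> C (Suc j)" using j conjugateD[OF R, of "Suc j" 0] by simp
    then have "even (Suc (C j) choose 1)" using g unfolding garnir_def by blast
    then show False using j by simp
  qed
  define e where "e = C j"
  have e0: "0 < e" using conjugateD[OF R, of j 0] j by (simp add: e_def)
  obtain i0 where i0: "j = Suc i0" using ja a by (cases j) auto
  have "even (Suc (C i0) choose 1)" using g e0 i0 unfolding garnir_def e_def by (metis Suc_leI One_nat_def order_refl)
  then have "odd (C i0)" by simp
  moreover have "e \<le> C i0" using conjugate_antimono[OF conjugate_sym[OF R], of i0 j] i0 by (simp add: e_def)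
  ultimately have "e < C i0" using j by (cases "e = C i0") (auto simp: e_def)
  \<comment> \<open>Row \<open>e\<close> lies just below the end of column \<open>j\<close>; it
    still meets column \<open>j - 1\<close> but not column \<open>j\<close>.\<close>
  then have "i0 < R e" using conjugateD[OF R] by blast
  moreover have "\<not> j < R e" using conjugateD[OF R, of j e] by (simp add: e_def)
  ultimately have Re: "R e = j" using i0 by simp
  have el: "e < ?l" using conjugateD[OF R, of 0 e] Re i0 by simp
  have le: "?l = Suc e"
  proof (rule ccontr)
    assume "?l \<noteq> Suc e"
    then have "odd j" using rows[of e] el Re by simp
    then show False using R0 ja by (metis even_Suc)
  qed
  have Ra: "R r = ?a" if "r < e" for r
    using conjugateD[OF R, of j r] that ja conjugate_antimono[OF R, of 0 r] by (simp add: e_def)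
  have Rz: "R r = 0" if "?l \<le> r" for r using conjugateD[OF R, of 0 r] that by simp
  have r: "R q = (if q < C 0 then R 0 else 0) - of_bool (q = C 0 - 1)" for q
  proof -
    consider "q < e" | "q = e" | "?l \<le> q" using le by linarith
    then show ?thesis
    proof cases
      case 1
      then show ?thesis using Ra[OF 1] le by simp
    next
      case 2
      then show ?thesis using Re le ja by simp
    next
      case 3
      then show ?thesis using Rz[OF 3] le by simp
    qed
  qed
  show "R r = (if r < C 0 then R 0 else 0) - of_bool (r = C 0 - 1)" by (rule r)
  have *: "q < C i \<longleftrightarrow> i < (if q < C 0 then R 0 else 0) - of_bool (q = C 0 - 1)" for q
    unfolding r[of q, symmetric] by (rule conjugateD[OF R, symmetric])
  show "C i = (if i < R 0 then C 0 else 0) - of_bool (i = R 0 - 1)"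
  proof -
    consider "i < ?a - 1" | "i = ?a - 1" | "?a \<le> i" by linarith
    then show ?thesis
    proof cases
      case 1
      have "C i \<le> ?l" by (rule conjugate_antimono[OF conjugate_sym[OF R]]) simp
      moreover have "e < C i" using *[of e] 1 le by simp
      ultimately show ?thesis using 1 le by simp
    next
      case 2
      then have "i = j" using ja by simp
      then show ?thesis using 2 le a ja by (simp add: e_def)
    next
      case 3
      then have "C i = 0" using *[of 0] by (cases "C i") (auto split: if_splits)
      then show ?thesis using 3 a by simp
    qed
  qed
qed

text \<open>The condition \<open>2 \<le> R 1\<close> puts the box \<open>(1, 1)\<close> into the
  diagram. It makes the binomial conditions for 1 and 2 available both for the first two rows and
  for the first two columns, which fixes \<open>R 0\<close> and \<open>C 0\<close> modulo 4.\<close>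

lemma sum_uniform_combination_nonhook:
  assumes char: "CHAR('a::field) = 2" and R: "conjugate R C" and X: "finite (X :: nat set)"
    and u: "uniform_combination X R C K (c :: 'k \<Rightarrow> 'a) s" and w: "has_content X w R"
    and g: "garnir C" and R1: "2 \<le> R 1"
  shows "(\<Sum>k\<in>K. c k) = 0"
proof -
  note row = row_condition[OF char R X u w]
  have rows: "odd (R r)" if "Suc r < C 0" for r
    using row[of 1 r] conjugateD[OF R, of 0 "Suc r"] that by simp
  have C1: "2 \<le> C 1" using conjugateD[OF R, of 1 1] R1 by simp
  have "even ((R 0 + 2) choose 2)" using row[of 2 0] R1 by simp
  moreover have "even (R 0 + 1)" using row[of 1 0] R1 by simp
  ultimately have a: "R 0 mod 4 = 3"
  proof -
    assume e: "even ((R 0 + 2) choose 2)" "even (R 0 + 1)"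
    \<comment> \<open>Pascal's rule, together with the evenness of \<open>Suc (R 0)\<close>, turns
      the row condition into one on \<open>Suc (R 0) choose 2\<close>.\<close>
    have "(R 0 + 2) choose 2 = (Suc (R 0) choose 2) + Suc (R 0)"
      by (simp add: numeral_2_eq_2)
    then show ?thesis using e by (intro mod_4_eq_3_if_choose_even) auto
  qed
  have "even (Suc (C 0) choose i)" if "1 \<le> i" "i \<le> C (Suc 0)" for i
    using g that unfolding garnir_def by blast
  from this[of 1] this[of 2] have l: "C 0 mod 4 = 3"
    using C1 by (intro mod_4_eq_3_if_choose_even) simp_all
  have a3: "3 \<le> R 0" and l3: "3 \<le> C 0" using a l mod_less_eq_dividend by metis+
  have Rz: "R r = 0" if "C 0 \<le> r" for r using conjugateD[OF R, of 0 r] that by simp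
  have oddR: "odd (R 0)" and oddC: "odd (C 0)" using a l by presburger+
  show ?thesis
  proof (cases "\<forall>j<R 0. odd (C j)")
    case True
    \<comment> \<open>The \<open>4 * q + 3\<close> rows consist of the first one and
      \<open>2 * q + 1\<close> pairs, so the total is \<open>3 + 2 * (2 * q + 1)\<close> modulo 4,
      which is 1.\<close>
    obtain q where q: "C 0 = 4 * q + 3" using l by (metis mult_div_mod_eq)
    have "card X = (\<Sum>r<C 0. R r)" by (rule card_eq_sum_rows[OF X w Rz])
    also have "C 0 = 2 * (2 * q + 1) + 1" using q by simp
    finally have "card X mod 4 = (3 + 2 * (2 * q + 1)) mod 4"
      using sum_rows_mod_4[OF R _ rows a, of "2 * q + 1"] True q by simp
    then have "card X mod 4 = 1" by presburger
    with True show ?thesis by (intro sum_uniform_combination_eq_0[OF char R X u g _ a]) simp_all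
  next
    case False
    then obtain j where j: "j < R 0" "even (C j)" by blast
    note shape = rectangle_minus_corner[OF R g rows R1 oddR j]
    let ?R = "\<lambda>r. if r < C 0 then R 0 else 0" and ?C = "\<lambda>j. if j < R 0 then C 0 else 0"
    obtain z where z: "z \<notin> X" using X ex_new_if_finite infinite_UNIV_nat by metis
    \<comment> \<open>With at least three rows and columns, the second row and the second column are
      still complete, so the parity conditions of the truncated shape give those of the whole
      rectangle.\<close>
    have RR: "R 1 = R 0" using shape(1)[of 1] l3 by simp
    have CC: "C 1 = C 0" using shape(2)[of 1] a3 by simp
    have "uniform_combination (insert z X) ?R ?C K c (\<lambda>k. (s k)(z := R 0 - 1))"
    proof (rule uniform_combination_rectangle[OF char X z _ _ shape u])
      show "even ((R 0 + v) choose v)" if "1 \<le> v" "v \<le> R 0" for v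
        by (rule row) (use that RR in simp_all)
    qed (use a3 l3 in linarith)+
    moreover have "garnir ?C"
      using g CC unfolding garnir_def by (auto split: if_splits)
    moreover have "conjugate ?R ?C" unfolding conjugate_def by (simp split: if_split)
    moreover have "card (insert z X) mod 4 = 1"
    proof -
      have "has_content (insert z X) (w(z := C 0 - 1)) ?R"
      proof (rule has_content_insert[OF X z w])
        show "?R r = R r + of_bool (r = C 0 - 1)" for r
          using a3 l3 by (subst shape(1)) auto
      qed
      then have "card (insert z X) = (\<Sum>r<C 0. ?R r)" by (rule card_eq_sum_rows[rotated]) (use X in auto)
      then have "card (insert z X) = C 0 * R 0" by simp
      also have "\<dots> mod 4 = (3 * 3) mod 4" using a l by (metis mod_mult_eq)
      finally show ?thesis by simp
    qed
    moreover have "finite (insert z X)" using X by simp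
    ultimately show ?thesis
      by (intro sum_uniform_combination_eq_0[OF char, of ?R ?C]) (use oddC a l3 in simp_all)
  qed
qed

section \<open>Words of tableaux\<close>

definition row_length :: "nat list \<Rightarrow> nat \<Rightarrow> nat" where
  "row_length \<mu> r = (if r < length \<mu> then \<mu> ! r else 0)"

definition column_length :: "nat list \<Rightarrow> nat \<Rightarrow> nat" where
  "column_length \<mu> j = card {r. j < row_length \<mu> r}"

text \<open>Values outside \<open>{1..n}\<close> carry no meaning, so words of tableaux are compared
  on \<open>{1..n}\<close> only.\<close>

definition row_word :: "nat list \<Rightarrow> tableau \<Rightarrow> nat \<Rightarrow> nat" where
  "row_word \<mu> t i = fst (inv_into (diagram \<mu>) t i)"

definition column_word :: "nat list \<Rightarrow> tableau \<Rightarrow> nat \<Rightarrow> nat" where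
  "column_word \<mu> t i = snd (inv_into (diagram \<mu>) t i)"

lemma diagram_eq_boxes: "diagram \<mu> = boxes (row_length \<mu>)"
  by (auto simp: diagram_def boxes_def row_length_def split: if_splits)

lemma down_closed_eq_lessThan:
  assumes "finite (S :: nat set)" "\<And>x y. x \<in> S \<Longrightarrow> y < x \<Longrightarrow> y \<in> S"
  shows "S = {..<card S}"
proof -
  define k where "k = (LEAST x. x \<notin> S)"
  obtain x where "x \<notin> S" using assms(1) ex_new_if_finite infinite_UNIV_nat by blast
  then have k: "k \<notin> S" unfolding k_def by (rule LeastI)
  have k': "y \<in> S" if "y < k" for y using not_less_Least[of y] that unfolding k_def by blast
  have "S = {..<k}"
  proof (intro equalityI subsetI)
    fix x assume x: "x \<in> S"
    then have "\<not> k < x" "k \<noteq> x" using assms(2) k by blast+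
    then show "x \<in> {..<k}" by simp
  qed (use k' in auto)
  then show ?thesis by simp
qed

lemma conjugate_row_column_length:
  assumes "sorted_wrt (\<ge>) \<mu>"
  shows "conjugate (row_length \<mu>) (column_length \<mu>)"
  unfolding conjugate_def
proof (intro allI)
  fix r j
  have "finite {r. j < row_length \<mu> r}"
    by (rule finite_subset[of _ "{..<length \<mu>}"]) (auto simp: row_length_def split: if_splits)
  moreover have "y \<in> {r. j < row_length \<mu> r}" if "x \<in> {r. j < row_length \<mu> r}" "y < x" for x y
  proof -
    have "x < length \<mu>" using that by (auto simp: row_length_def split: if_splits)
    then have "\<mu> ! x \<le> \<mu> ! y" using sorted_wrt_nth_less[OF assms that(2)] by simp
    then show ?thesis using that \<open>x < length \<mu>\<close> by (simp add: row_length_def)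
  qed
  ultimately have "{r. j < row_length \<mu> r} = {..<column_length \<mu> j}"
    unfolding column_length_def by (rule down_closed_eq_lessThan)
  then show "j < row_length \<mu> r \<longleftrightarrow> r < column_length \<mu> j" by blast
qed

text \<open>If the second row had at most one box, so would every later row, and the partition would
  be a hook.\<close>

lemma two_le_row_length_1:
  assumes "is_partition n \<mu>" "\<not> is_hook n \<mu>" "n \<ge> 1"
  shows "2 \<le> row_length \<mu> 1"
proof (rule ccontr)
  assume short: "\<not> 2 \<le> row_length \<mu> 1"
  have part: "sorted_wrt (\<ge>) \<mu>" "0 \<notin> set \<mu>" "sum_list \<mu> = n"
    using assms(1) by (auto simp: is_partition_def)
  obtain x xs where mu: "\<mu> = x # xs" using part assms(3) by (cases \<mu>) auto
  have "y = 1" if "y \<in> set xs" for y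
  proof -
    obtain i where i: "i < length xs" "xs ! i = y" using \<open>y \<in> set xs\<close> by (metis in_set_conv_nth)
    have "row_length \<mu> (Suc i) \<le> row_length \<mu> 1"
      using conjugate_antimono[OF conjugate_row_column_length[OF part(1)]] by simp
    then have "y \<le> 1" using short i mu by (simp add: row_length_def)
    then show ?thesis using part(2) that mu by (cases y) auto
  qed
  then have xs: "xs = replicate (length xs) 1" by (intro replicate_eqI) auto
  have "sum_list xs = sum_list (replicate (length xs) 1)" by (rule arg_cong[OF xs])
  also have "\<dots> = length xs" by (simp add: sum_list_replicate)
  finally have "n = x + length xs" using part(3) mu by simp
  moreover have "x \<noteq> 0" using part(2) mu by auto
  ultimately have n: "n - length xs = x" "length xs \<le> n - 1" by simp_all
  have "\<mu> = (n - length xs) # replicate (length xs) 1"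
    unfolding mu n(1) by (rule arg_cong[OF xs])
  then have "is_hook n \<mu>" unfolding is_hook_def using n(2) by blast
  then show False using assms(2) by simp
qed

context
  fixes n :: nat and \<mu> :: "nat list"
begin

abbreviation "tabs \<equiv> tableaux n \<mu>"
abbreviation "fit \<equiv> fits {1..n} (diagram \<mu>)"
abbreviation "rw \<equiv> row_word \<mu>"
abbreviation "cw \<equiv> column_word \<mu>"

lemma fit_words: "t \<in> tabs \<Longrightarrow> fit (rw t) (cw t)"
  by (simp add: fits_def row_word_def column_word_def tableaux_def bij_betw_inv_into)

lemma tableau_at_words:
  assumes "t \<in> tabs" "i \<in> {1..n}"
  shows "(rw t i, cw t i) \<in> diagram \<mu>" "t (rw t i, cw t i) = i"
proof -
  have im: "t ` diagram \<mu> = {1..n}" using assms(1) by (simp add: tableaux_def bij_betw_def)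
  show "(rw t i, cw t i) \<in> diagram \<mu>" using inv_into_into[of i t "diagram \<mu>"] assms(2) im
    by (simp add: row_word_def column_word_def)
  show "t (rw t i, cw t i) = i" using f_inv_into_f[of i t "diagram \<mu>"] assms(2) im
    by (simp add: row_word_def column_word_def)
qed

lemma words_at_box:
  assumes "t \<in> tabs" "b \<in> diagram \<mu>"
  shows "t b \<in> {1..n}" "rw t (t b) = fst b" "cw t (t b) = snd b"
proof -
  have b: "bij_betw t (diagram \<mu>) {1..n}" using assms(1) by (simp add: tableaux_def)
  show "t b \<in> {1..n}" using b assms(2) by (rule bij_betw_apply)
  have "inv_into (diagram \<mu>) t (t b) = b" using b assms(2) by (simp add: bij_betw_def inv_into_f_f)
  then show "rw t (t b) = fst b" "cw t (t b) = snd b" by (simp_all add: row_word_def column_word_def)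
qed

lemma finite_diagram: "finite (diagram \<mu>)"
proof -
  have "diagram \<mu> = (SIGMA i:{..<length \<mu>}. {..<\<mu> ! i})" by (auto simp: diagram_def)
  then show ?thesis by simp
qed

lemma finite_tableaux: "finite tabs"
proof -
  have "finite {t :: tableau. \<forall>x. (x \<in> diagram \<mu> \<longrightarrow> t x \<in> {1..n}) \<and> (x \<notin> diagram \<mu> \<longrightarrow> t x = 0)}"
    using finite_diagram by (intro finite_set_of_finite_funs) auto
  then show ?thesis by (rule finite_subset[rotated]) (auto simp: tableaux_def bij_betw_def)
qed

lemma permute_tableau:
  assumes "t \<in> tabs" "\<pi> permutes {1..n}"
  shows "\<pi> \<circ> t \<in> tabs"
  using assms bij_betw_trans[OF _ permutes_imp_bij[OF assms(2)]] permutes_not_in[OF assms(2), of 0]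
  by (auto simp: tableaux_def)

lemma words_permute:
  assumes "t \<in> tabs" "\<pi> permutes {1..n}" "i \<in> {1..n}"
  shows "rw (\<pi> \<circ> t) (\<pi> i) = rw t i" "cw (\<pi> \<circ> t) (\<pi> i) = cw t i"
  using words_at_box(2,3)[OF permute_tableau[OF assms(1,2)], of "(rw t i, cw t i)"] tableau_at_words[OF assms(1,3)]
  by simp_all

lemma tableau_eqI:
  assumes "t \<in> tabs" "t' \<in> tabs" "\<And>i. i \<in> {1..n} \<Longrightarrow> rw t i = rw t' i \<and> cw t i = cw t' i"
  shows "t = t'"
proof
  fix b
  show "t b = t' b"
  proof (cases "b \<in> diagram \<mu>")
    case True
    note b = words_at_box[OF assms(1) True]
    have "t' (rw t' (t b), cw t' (t b)) = t b" by (rule tableau_at_words(2)[OF assms(2) b(1)])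
    moreover have "rw t' (t b) = fst b" "cw t' (t b) = snd b" using assms(3)[OF b(1)] b by simp_all
    ultimately have "t' (fst b, snd b) = t b" by (simp only:)
    then show ?thesis by simp
  next
    case False
    then have "t b = 0" "t' b = 0" using assms(1,2) unfolding tableaux_def by blast+
    then show ?thesis by simp
  qed
qed

lemma exists_tableau:
  assumes "fit w s"
  obtains t where "t \<in> tabs" "\<And>i. i \<in> {1..n} \<Longrightarrow> rw t i = w i \<and> cw t i = s i"
proof -
  define f where "f i = (w i, s i)" for i
  have f: "bij_betw f {1..n} (diagram \<mu>)" using assms by (simp add: fits_def f_def[abs_def])
  define t where "t b = (if b \<in> diagram \<mu> then inv_into {1..n} f b else 0)" for b
  have "bij_betw t (diagram \<mu>) {1..n}"
    using bij_betw_inv_into[OF f] by (subst bij_betw_cong[of _ _ "inv_into {1..n} f"]) (auto simp: t_def)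
  then have t: "t \<in> tabs" by (simp add: tableaux_def t_def)
  moreover have "rw t i = w i \<and> cw t i = s i" if "i \<in> {1..n}" for i
  proof -
    have "f i \<in> diagram \<mu>" using f that by (rule bij_betw_apply)
    moreover have "t (f i) = i" using f that calculation by (simp add: t_def bij_betw_def inv_into_f_f)
    ultimately show ?thesis using words_at_box(2,3)[OF t, of "f i"] by (simp add: f_def)
  qed
  ultimately show thesis using that by blast
qed

lemma exists_permutation:
  assumes "t \<in> tabs" "t' \<in> tabs"
  obtains \<pi> where "\<pi> permutes {1..n}" "t' = \<pi> \<circ> t"
proof -
  define \<pi> where "\<pi> i = (if i \<in> {1..n} then t' (inv_into (diagram \<mu>) t i) else i)" for i
  have b: "bij_betw t (diagram \<mu>) {1..n}" "bij_betw t' (diagram \<mu>) {1..n}"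
    using assms by (auto simp: tableaux_def)
  have "bij_betw (t' \<circ> inv_into (diagram \<mu>) t) {1..n} {1..n}"
    using bij_betw_inv_into[OF b(1)] b(2) by (rule bij_betw_trans)
  then have "bij_betw \<pi> {1..n} {1..n}" by (subst bij_betw_cong) (auto simp: \<pi>_def)
  then have "\<pi> permutes {1..n}" by (rule bij_imp_permutes) (auto simp: \<pi>_def)
  moreover have "t' x = (\<pi> \<circ> t) x" for x
  proof (cases "x \<in> diagram \<mu>")
    case True
    then have "inv_into (diagram \<mu>) t (t x) = x" "t x \<in> {1..n}"
      using b(1) by (auto simp: bij_betw_def inv_into_f_f)
    then show ?thesis by (simp add: \<pi>_def)
  next
    case False
    then have "t x = 0" "t' x = 0" using assms(1,2) unfolding tableaux_def by blast+
    then show ?thesis by (simp add: \<pi>_def)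
  qed
  ultimately show thesis using that by blast
qed

lemma row_stabilizer_iff:
  assumes t: "t \<in> tabs"
  shows "\<pi> \<in> row_stabilizer n \<mu> t \<longleftrightarrow> \<pi> permutes {1..n} \<and> (\<forall>i\<in>{1..n}. rw t (\<pi> i) = rw t i)"
proof (intro iffI conjI ballI)
  assume p: "\<pi> \<in> row_stabilizer n \<mu> t"
  then show "\<pi> permutes {1..n}" by (simp add: row_stabilizer_def)
  fix i assume i: "i \<in> {1..n}"
  obtain y where "y \<in> diagram \<mu>" "fst y = rw t i" "\<pi> i = t y"
    using p tableau_at_words[OF t i] unfolding row_stabilizer_def by fastforce
  then show "rw t (\<pi> i) = rw t i" using words_at_box[OF t] by simp
next
  assume p: "\<pi> permutes {1..n} \<and> (\<forall>i\<in>{1..n}. rw t (\<pi> i) = rw t i)"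
  have "\<exists>y\<in>diagram \<mu>. fst y = fst x \<and> \<pi> (t x) = t y" if x: "x \<in> diagram \<mu>" for x
  proof -
    have i: "t x \<in> {1..n}" "rw t (t x) = fst x" using words_at_box[OF t x] by auto
    then have "\<pi> (t x) \<in> {1..n}" using p permutes_in_image[of \<pi> "{1..n}" "t x"] by simp
    then show ?thesis using tableau_at_words[OF t, of "\<pi> (t x)"] p i
      by (intro bexI[of _ "(rw t (\<pi> (t x)), cw t (\<pi> (t x)))"]) auto
  qed
  then show "\<pi> \<in> row_stabilizer n \<mu> t" using p by (simp add: row_stabilizer_def)
qed

lemma column_stabilizer_iff:
  assumes t: "t \<in> tabs"
  shows "\<pi> \<in> column_stabilizer n \<mu> t \<longleftrightarrow> \<pi> permutes {1..n} \<and> (\<forall>i\<in>{1..n}. cw t (\<pi> i) = cw t i)"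
proof (intro iffI conjI ballI)
  assume p: "\<pi> \<in> column_stabilizer n \<mu> t"
  then show "\<pi> permutes {1..n}" by (simp add: column_stabilizer_def)
  fix i assume i: "i \<in> {1..n}"
  obtain y where "y \<in> diagram \<mu>" "snd y = cw t i" "\<pi> i = t y"
    using p tableau_at_words[OF t i] unfolding column_stabilizer_def by fastforce
  then show "cw t (\<pi> i) = cw t i" using words_at_box[OF t] by simp
next
  assume p: "\<pi> permutes {1..n} \<and> (\<forall>i\<in>{1..n}. cw t (\<pi> i) = cw t i)"
  have "\<exists>y\<in>diagram \<mu>. snd y = snd x \<and> \<pi> (t x) = t y" if x: "x \<in> diagram \<mu>" for x
  proof -
    have i: "t x \<in> {1..n}" "cw t (t x) = snd x" using words_at_box[OF t x] by auto
    then have "\<pi> (t x) \<in> {1..n}" using p permutes_in_image[of \<pi> "{1..n}" "t x"] by simp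
    then show ?thesis using tableau_at_words[OF t, of "\<pi> (t x)"] p i
      by (intro bexI[of _ "(rw t (\<pi> (t x)), cw t (\<pi> (t x)))"]) auto
  qed
  then show "\<pi> \<in> column_stabilizer n \<mu> t" using p by (simp add: column_stabilizer_def)
qed

lemma words_permute':
  assumes "t \<in> tabs" "\<pi> permutes {1..n}" "i \<in> {1..n}"
  shows "rw (\<pi> \<circ> t) i = rw t (inv \<pi> i)" "cw (\<pi> \<circ> t) i = cw t (inv \<pi> i)"
proof -
  have "inv \<pi> i \<in> {1..n}" using permutes_in_image[OF permutes_inv[OF assms(2)]] assms(3) by blast
  then show "rw (\<pi> \<circ> t) i = rw t (inv \<pi> i)" "cw (\<pi> \<circ> t) i = cw t (inv \<pi> i)"
    using words_permute[OF assms(1,2), of "inv \<pi> i"] permutes_inverses(1)[OF assms(2), of i] by simp_all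
qed

text \<open>This identifies tabloids with row words. Any two tableaux are related by a permutation
  of the entries, and it preserves the rows of \<open>t\<close> exactly when the row words
  agree.\<close>

lemma tabloid_of_eq:
  assumes t: "t \<in> tabs"
  shows "tabloid_of n \<mu> t = {t'\<in>tabs. \<forall>i\<in>{1..n}. rw t' i = rw t i}"
proof (intro equalityI subsetI)
  fix t' assume "t' \<in> tabloid_of n \<mu> t"
  then obtain \<pi> where p: "\<pi> permutes {1..n}" "\<forall>i\<in>{1..n}. rw t (\<pi> i) = rw t i" "t' = \<pi> \<circ> t"
    using row_stabilizer_iff[OF t] by (auto simp: tabloid_of_def)
  have "rw (\<pi> \<circ> t) i = rw t i" if i: "i \<in> {1..n}" for i
  proof -
    have "inv \<pi> i \<in> {1..n}" using permutes_in_image[OF permutes_inv[OF p(1)]] i by blast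
    then have "rw t (\<pi> (inv \<pi> i)) = rw t (inv \<pi> i)" using p(2) by blast
    then show ?thesis using words_permute'[OF t p(1) i] permutes_inverses(1)[OF p(1)] by simp
  qed
  then show "t' \<in> {t'\<in>tabs. \<forall>i\<in>{1..n}. rw t' i = rw t i}" using permute_tableau[OF t p(1)] p(3) by blast
next
  fix t' assume t': "t' \<in> {t'\<in>tabs. \<forall>i\<in>{1..n}. rw t' i = rw t i}"
  then obtain \<pi> where p: "\<pi> permutes {1..n}" "t' = \<pi> \<circ> t" using exists_permutation[OF t] by blast
  have "rw t (\<pi> i) = rw t i" if i: "i \<in> {1..n}" for i
  proof -
    have "\<pi> i \<in> {1..n}" using permutes_in_image[OF p(1)] i by blast
    then show ?thesis using words_permute(1)[OF t p(1) i] t' p(2) by auto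
  qed
  then have "\<pi> \<in> row_stabilizer n \<mu> t" using row_stabilizer_iff[OF t] p by blast
  then show "t' \<in> tabloid_of n \<mu> t" using p by (auto simp: tabloid_of_def)
qed

lemma tabloid_of_eq_iff:
  assumes "t \<in> tabs" "t' \<in> tabs"
  shows "tabloid_of n \<mu> t = tabloid_of n \<mu> t' \<longleftrightarrow> (\<forall>i\<in>{1..n}. rw t i = rw t' i)"
proof
  assume "tabloid_of n \<mu> t = tabloid_of n \<mu> t'"
  moreover have "t \<in> tabloid_of n \<mu> t" using assms(1) tabloid_of_eq by blast
  ultimately show "\<forall>i\<in>{1..n}. rw t i = rw t' i" using tabloid_of_eq[OF assms(2)] by blast
next
  assume "\<forall>i\<in>{1..n}. rw t i = rw t' i"
  then show "tabloid_of n \<mu> t = tabloid_of n \<mu> t'" unfolding tabloid_of_eq[OF assms(1)] tabloid_of_eq[OF assms(2)] by simp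
qed

lemma permute_tabloid:
  assumes t: "t \<in> tabs" and p: "\<pi> permutes {1..n}"
  shows "(\<lambda>t. \<pi> \<circ> t) ` tabloid_of n \<mu> t = tabloid_of n \<mu> (\<pi> \<circ> t)"
proof -
  have sub: "(\<lambda>t. \<pi> \<circ> t) ` tabloid_of n \<mu> t \<subseteq> tabloid_of n \<mu> (\<pi> \<circ> t)"
    if t: "t \<in> tabs" and p: "\<pi> permutes {1..n}" for t \<pi>
  proof
    fix t' assume "t' \<in> (\<lambda>t. \<pi> \<circ> t) ` tabloid_of n \<mu> t"
    then obtain u where u: "u \<in> tabs" "\<forall>i\<in>{1..n}. rw u i = rw t i" "t' = \<pi> \<circ> u"
      unfolding tabloid_of_eq[OF t] by blast
    have "rw (\<pi> \<circ> u) i = rw (\<pi> \<circ> t) i" if i: "i \<in> {1..n}" for i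
    proof -
      have "inv \<pi> i \<in> {1..n}" using permutes_in_image[OF permutes_inv[OF p]] i by blast
      then show ?thesis using words_permute'(1)[OF t p i] words_permute'(1)[OF u(1) p i] u(2) by simp
    qed
    then show "t' \<in> tabloid_of n \<mu> (\<pi> \<circ> t)"
      unfolding tabloid_of_eq[OF permute_tableau[OF t p]] using permute_tableau[OF u(1) p] u(3) by blast
  qed
  have c: "inv \<pi> \<circ> (\<pi> \<circ> x) = x" "\<pi> \<circ> (inv \<pi> \<circ> x) = x" for x :: tableau
    using permutes_inverses[OF p] by (auto simp: fun_eq_iff)
  have "(\<lambda>t. inv \<pi> \<circ> t) ` tabloid_of n \<mu> (\<pi> \<circ> t) \<subseteq> tabloid_of n \<mu> (inv \<pi> \<circ> (\<pi> \<circ> t))"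
    by (rule sub[OF permute_tableau[OF t p] permutes_inv[OF p]])
  then have s: "(\<lambda>t. inv \<pi> \<circ> t) ` tabloid_of n \<mu> (\<pi> \<circ> t) \<subseteq> tabloid_of n \<mu> t" unfolding c .
  have "tabloid_of n \<mu> (\<pi> \<circ> t) \<subseteq> (\<lambda>t. \<pi> \<circ> t) ` tabloid_of n \<mu> t"
  proof
    fix x assume "x \<in> tabloid_of n \<mu> (\<pi> \<circ> t)"
    then have "inv \<pi> \<circ> x \<in> tabloid_of n \<mu> t" using s by blast
    then show "x \<in> (\<lambda>t. \<pi> \<circ> t) ` tabloid_of n \<mu> t" using c(2)[of x] by (metis imageI)
  qed
  then show ?thesis using sub[OF t p] by blast
qed

text \<open>All signs are 1, so the coefficient counts the column permutations that produce the row
  word of \<open>t'\<close>. The resulting tableau has prescribed row and column words; hence there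
  is at most one, and it exists exactly when the two words fit.\<close>

lemma lookup_polytabloid:
  assumes char: "CHAR('a::field) = 2" and t: "t \<in> tabs" "t' \<in> tabs"
  shows "Poly_Mapping.lookup (polytabloid n \<mu> t :: tabloid \<Rightarrow>\<^sub>0 'a) (tabloid_of n \<mu> t') = of_bool (fit (rw t') (cw t))"
proof -
  define P where "P = {\<pi>\<in>column_stabilizer n \<mu> t. tabloid_of n \<mu> (\<pi> \<circ> t) = tabloid_of n \<mu> t'}"
  have fin: "finite (column_stabilizer n \<mu> t)"
    by (rule finite_subset[OF _ finite_permutations[of "{1..n}"]]) (auto simp: column_stabilizer_def)
  have "(-1 :: 'a) = 1"
  proof -
    have "(1 :: 'a) + 1 = 0" using of_nat_char_2[OF char, of 2] by simp
    then show ?thesis by (metis add_eq_0_iff)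
  qed
  then have sgn: "(of_int (sign \<pi>) :: 'a) = 1" for \<pi> :: "nat \<Rightarrow> nat" by (simp add: sign_def)
  have "Poly_Mapping.lookup (polytabloid n \<mu> t :: tabloid \<Rightarrow>\<^sub>0 'a) (tabloid_of n \<mu> t') =
      (\<Sum>\<pi>\<in>column_stabilizer n \<mu> t. of_bool (tabloid_of n \<mu> (\<pi> \<circ> t) = tabloid_of n \<mu> t'))"
    unfolding polytabloid_def sgn by (simp add: lookup_sum lookup_single when_def of_bool_def)
  also have "\<dots> = of_nat (card P)" using fin by (simp add: P_def sum.If_cases of_bool_def Int_def)
  also have "\<dots> = of_bool (fit (rw t') (cw t))"
  proof -
    have mem: "\<pi> \<in> P \<longleftrightarrow> \<pi> permutes {1..n} \<and> (\<forall>i\<in>{1..n}. rw (\<pi> \<circ> t) i = rw t' i \<and> cw (\<pi> \<circ> t) i = cw t i)" for \<pi>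
    proof -
      have "(\<forall>i\<in>{1..n}. cw t (\<pi> i) = cw t i) \<longleftrightarrow> (\<forall>i\<in>{1..n}. cw (\<pi> \<circ> t) i = cw t i)" if p: "\<pi> permutes {1..n}"
      proof
        assume c: "\<forall>i\<in>{1..n}. cw t (\<pi> i) = cw t i"
        show "\<forall>i\<in>{1..n}. cw (\<pi> \<circ> t) i = cw t i"
        proof
          fix i assume i: "i \<in> {1..n}"
          have "inv \<pi> i \<in> {1..n}" using permutes_in_image[OF permutes_inv[OF p]] i by blast
          then have "cw t (\<pi> (inv \<pi> i)) = cw t (inv \<pi> i)" using c by blast
          then show "cw (\<pi> \<circ> t) i = cw t i" using words_permute'(2)[OF t(1) p i] permutes_inverses(1)[OF p] by simp
        qed
      next
        assume c: "\<forall>i\<in>{1..n}. cw (\<pi> \<circ> t) i = cw t i"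
        show "\<forall>i\<in>{1..n}. cw t (\<pi> i) = cw t i"
        proof
          fix i assume i: "i \<in> {1..n}"
          have "\<pi> i \<in> {1..n}" using permutes_in_image[OF p] i by blast
          then show "cw t (\<pi> i) = cw t i" using c words_permute(2)[OF t(1) p i] by simp
        qed
      qed
      then show ?thesis
        unfolding P_def mem_Collect_eq column_stabilizer_iff[OF t(1)]
        using tabloid_of_eq_iff[OF permute_tableau[OF t(1), of \<pi>] t(2)] by blast
    qed
    show ?thesis
    proof (cases "fit (rw t') (cw t)")
      case False
      have "\<pi> \<notin> P" for \<pi>
      proof
        assume p: "\<pi> \<in> P"
        then have "fit (rw (\<pi> \<circ> t)) (cw (\<pi> \<circ> t))" using mem permute_tableau[OF t(1)] fit_words by blast
        then show False using False mem p fits_cong[of "{1..n}" "rw (\<pi> \<circ> t)" "rw t'" "cw (\<pi> \<circ> t)" "cw t"] by blast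
      qed
      then have "P = {}" by blast
      then show ?thesis using False by simp
    next
      case True
      then obtain u where u: "u \<in> tabs" "\<And>i. i \<in> {1..n} \<Longrightarrow> rw u i = rw t' i \<and> cw u i = cw t i"
        by (rule exists_tableau) blast
      obtain \<pi> where p: "\<pi> permutes {1..n}" "u = \<pi> \<circ> t" using exists_permutation[OF t(1) u(1)] by blast
      have "P = {\<pi>}"
      proof (intro equalityI subsetI)
        fix \<rho> assume r: "\<rho> \<in> P"
        then have rp: "\<rho> permutes {1..n}" using mem by blast
        have "\<rho> \<circ> t = u"
          by (rule tableau_eqI[OF permute_tableau[OF t(1) rp] u(1)]) (use r mem u(2) in simp)
        then have e: "\<rho> (t b) = \<pi> (t b)" for b using p(2) by (metis comp_apply)
        have "\<rho> i = \<pi> i" for i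
        proof (cases "i \<in> {1..n}")
          case True
          then show ?thesis using e tableau_at_words(2)[OF t(1) True] by metis
        next
          case False
          then show ?thesis using permutes_not_in rp p(1) by metis
        qed
        then show "\<rho> \<in> {\<pi>}" by auto
      qed (use mem u p in blast)
      then show ?thesis using True by simp
    qed
  qed
  finally show ?thesis .
qed

lemma lookup_polytabloid_eq_0:
  assumes t: "t \<in> tabs" and T: "T \<notin> tabloid_of n \<mu> ` tabs"
  shows "Poly_Mapping.lookup (polytabloid n \<mu> t :: tabloid \<Rightarrow>\<^sub>0 'a::field) T = 0"
proof -
  have "tabloid_of n \<mu> (\<pi> \<circ> t) \<noteq> T" if "\<pi> \<in> column_stabilizer n \<mu> t" for \<pi>
    using that column_stabilizer_iff[OF t] permute_tableau[OF t] T by blast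
  then show ?thesis unfolding polytabloid_def by (simp add: lookup_sum lookup_single when_def)
qed

lemma lookup_act:
  assumes p: "\<pi> permutes {1..n}"
  shows "Poly_Mapping.lookup (act \<pi> v) T = Poly_Mapping.lookup (v :: tabloid \<Rightarrow>\<^sub>0 'a::field) ((\<lambda>t. inv \<pi> \<circ> t) ` T)"
proof -
  have c: "inv \<pi> \<circ> (\<pi> \<circ> x) = x" "\<pi> \<circ> (inv \<pi> \<circ> x) = x" for x :: tableau
    using permutes_inverses[OF p] by (auto simp: fun_eq_iff)
  have eq: "(\<lambda>t. \<pi> \<circ> t) ` S = T \<longleftrightarrow> S = (\<lambda>t. inv \<pi> \<circ> t) ` T" for S :: tabloid
    by (auto simp: image_image c)
  have "Poly_Mapping.lookup (act \<pi> v) T =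
      (\<Sum>S\<in>Poly_Mapping.keys v. if S = (\<lambda>t. inv \<pi> \<circ> t) ` T then Poly_Mapping.lookup v S else 0)"
    unfolding act_def by (simp add: lookup_sum lookup_single when_def eq)
  also have "\<dots> = Poly_Mapping.lookup v ((\<lambda>t. inv \<pi> \<circ> t) ` T)"
    by (simp add: in_keys_iff)
  finally show ?thesis .
qed

lemma act_polytabloid:
  assumes char: "CHAR('a::field) = 2" and t: "t \<in> tabs" and p: "\<pi> permutes {1..n}"
  shows "act \<pi> (polytabloid n \<mu> t) = (polytabloid n \<mu> (\<pi> \<circ> t) :: tabloid \<Rightarrow>\<^sub>0 'a)"
proof (rule poly_mapping_eqI)
  fix T
  have c: "inv \<pi> \<circ> (\<pi> \<circ> x) = x" "\<pi> \<circ> (inv \<pi> \<circ> x) = x" for x :: tableau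
    using permutes_inverses[OF p] by (auto simp: fun_eq_iff)
  have pt: "\<pi> \<circ> t \<in> tabs" by (rule permute_tableau[OF t p])
  show "Poly_Mapping.lookup (act \<pi> (polytabloid n \<mu> t)) T = Poly_Mapping.lookup (polytabloid n \<mu> (\<pi> \<circ> t) :: tabloid \<Rightarrow>\<^sub>0 'a) T"
  proof (cases "T \<in> tabloid_of n \<mu> ` tabs")
    case True
    then obtain t' where t': "t' \<in> tabs" "T = tabloid_of n \<mu> t'" by blast
    have it: "inv \<pi> \<circ> t' \<in> tabs" by (rule permute_tableau[OF t'(1) permutes_inv[OF p]])
    \<comment> \<open>Both words are pulled back along the same permutation, which does not affect
      fitting.\<close>
    have "fit (rw (inv \<pi> \<circ> t')) (cw t) \<longleftrightarrow> fit (rw t' \<circ> \<pi>) (cw (\<pi> \<circ> t) \<circ> \<pi>)"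
    proof (rule fits_cong)
      fix i assume i: "i \<in> {1..n}"
      show "rw (inv \<pi> \<circ> t') i = (rw t' \<circ> \<pi>) i"
        using words_permute'(1)[OF t'(1) permutes_inv[OF p] i] permutes_inv_inv[OF p] by simp
      show "cw t i = (cw (\<pi> \<circ> t) \<circ> \<pi>) i" using words_permute(2)[OF t p i] by simp
    qed
    then have "fit (rw (inv \<pi> \<circ> t')) (cw t) \<longleftrightarrow> fit (rw t') (cw (\<pi> \<circ> t))"
      using fits_permute[OF p] by blast
    then show ?thesis
      unfolding lookup_act[OF p] t'(2) permute_tabloid[OF t'(1) permutes_inv[OF p]]
        lookup_polytabloid[OF char t it] lookup_polytabloid[OF char pt t'(1)] by simp
  next
    case False
    have notin: "(\<lambda>t. inv \<pi> \<circ> t) ` T \<notin> tabloid_of n \<mu> ` tabs"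
    proof
      assume "(\<lambda>t. inv \<pi> \<circ> t) ` T \<in> tabloid_of n \<mu> ` tabs"
      then obtain u where u: "u \<in> tabs" "(\<lambda>t. inv \<pi> \<circ> t) ` T = tabloid_of n \<mu> u" by blast
      then have "(\<lambda>t. \<pi> \<circ> t) ` (\<lambda>t. inv \<pi> \<circ> t) ` T = tabloid_of n \<mu> (\<pi> \<circ> u)"
        using permute_tabloid[OF u(1) p] by simp
      then show False using False permute_tableau[OF u(1) p] by (simp add: image_image c)
    qed
    show ?thesis
      unfolding lookup_act[OF p] lookup_polytabloid_eq_0[OF t notin] lookup_polytabloid_eq_0[OF pt False] ..
  qed
qed

end

section \<open>One-dimensional direct summands\<close>

lemma transpose_invariant_if_dim_1:
  assumes char: "CHAR('a::field) = 2" and u: "is_submodule n (tabloid_space.span {u :: tabloid \<Rightarrow>\<^sub>0 'a})"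
    and u0: "u \<noteq> 0" and ab: "a \<in> {1..n}" "b \<in> {1..n}"
  shows "act (transpose a b) u = u"
proof -
  let ?t = "transpose a b"
  have p: "?t permutes {1..n}" using ab by (rule permutes_swap_id)
  have "act ?t u \<in> tabloid_space.span {u}"
    using u p tabloid_space.span_base[of u "{u}"] by (simp add: is_submodule_def)
  then obtain \<chi> where chi: "act ?t u = scale \<chi> u" by (auto simp: tabloid_space.span_singleton)
  have i: "inv ?t = ?t" by (rule inv_unique_comp; simp)
  obtain T where T: "Poly_Mapping.lookup u T \<noteq> 0" using u0 by (metis lookup_zero poly_mapping_eqI)
  have l: "Poly_Mapping.lookup u ((\<lambda>t. ?t \<circ> t) ` S) = \<chi> * Poly_Mapping.lookup u S" for S
    using arg_cong[OF chi, of "\<lambda>v. Poly_Mapping.lookup v S"] by (simp add: lookup_act[OF p] i lookup_scale)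
  have "(\<lambda>t. ?t \<circ> t) ` (\<lambda>t. ?t \<circ> t) ` T = T" by (simp add: image_image comp_assoc[symmetric])
  \<comment> \<open>A transposition acts by a scalar with square 1. In characteristic 2 this means
    \<open>(\<chi> - 1) * (\<chi> - 1) = 0\<close>, so the scalar is 1.\<close>
  then have "\<chi> * \<chi> = 1" using l[of "(\<lambda>t. ?t \<circ> t) ` T"] l[of T] T by simp
  then have "(\<chi> - 1) * (\<chi> + 1) = 0" by (simp add: algebra_simps)
  moreover have "(1 :: 'a) + 1 = 0" using of_nat_char_2[OF char, of 2] by simp
  then have "- 1 = (1 :: 'a)" by (metis add_eq_0_iff)
  then have "\<chi> + 1 = \<chi> - 1" by (metis diff_minus_eq_add)
  ultimately have "(\<chi> - 1) * (\<chi> - 1) = 0" by simp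
  then have "\<chi> = 1" by simp
  then show ?thesis using chi by simp
qed

text \<open>Modulo \<open>W\<close> every polytabloid equals \<open>scale \<kappa> u\<close>. A
  vanishing sum of polytabloids with an odd number of terms would put this nonzero vector into
  \<open>W\<close>.\<close>

lemma column_words_garnir:
  assumes char: "CHAR('a::field) = 2" and part: "sorted_wrt (\<ge>) \<mu>"
    and t0: "t0 \<in> tableaux n \<mu>" and u0: "u \<noteq> (0 :: tabloid \<Rightarrow>\<^sub>0 'a)"
    and W: "tabloid_space.subspace W" "tabloid_space.span {u} \<inter> W = {0}"
    and k: "\<kappa> \<noteq> 0" and poly: "\<And>t. t \<in> tableaux n \<mu> \<Longrightarrow> polytabloid n \<mu> t - scale \<kappa> u \<in> W"
  shows "garnir (column_length \<mu>)"
proof (rule garnir_if_relations_even)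
  show conj: "conjugate (row_length \<mu>) (column_length \<mu>)" by (rule conjugate_row_column_length[OF part])
  show "finite {1..n}" by simp
  show "has_content {1..n} (column_word \<mu> t0) (column_length \<mu>)"
    using content_col_fits[OF conj] fit_words[OF t0] by (simp add: diagram_eq_boxes)
  fix F :: "nat set set" and s :: "nat set \<Rightarrow> nat \<Rightarrow> nat"
  assume F: "finite F" and s: "\<And>B. B \<in> F \<Longrightarrow> has_content {1..n} (s B) (column_length \<mu>)"
    and even: "\<And>w. even (card {B \<in> F. fits {1..n} (boxes (row_length \<mu>)) w (s B)})"
  have "\<exists>t\<in>tableaux n \<mu>. \<forall>i\<in>{1..n}. column_word \<mu> t i = s B i" if B: "B \<in> F" for B
  proof -
    have "fits {1..n} (diagram \<mu>) (column_rank {1..n} (s B)) (s B)"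
      unfolding diagram_eq_boxes by (rule fits_column_rank[OF conj _ s[OF B]]) simp
    then show ?thesis by (rule exists_tableau) blast
  qed
  then obtain t where t: "\<And>B. B \<in> F \<Longrightarrow> t B \<in> tableaux n \<mu>"
    "\<And>B i. B \<in> F \<Longrightarrow> i \<in> {1..n} \<Longrightarrow> column_word \<mu> (t B) i = s B i" by metis
  have "(\<Sum>B\<in>F. polytabloid n \<mu> (t B)) = (0 :: tabloid \<Rightarrow>\<^sub>0 'a)"
  proof (rule poly_mapping_eqI)
    fix T
    show "Poly_Mapping.lookup (\<Sum>B\<in>F. polytabloid n \<mu> (t B)) T = Poly_Mapping.lookup (0 :: tabloid \<Rightarrow>\<^sub>0 'a) T"
    proof (cases "T \<in> tabloid_of n \<mu> ` tableaux n \<mu>")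
      case True
      then obtain t' where t': "t' \<in> tableaux n \<mu>" "T = tabloid_of n \<mu> t'" by blast
      let ?w = "row_word \<mu> t'"
      have "fits {1..n} (diagram \<mu>) ?w (column_word \<mu> (t B)) \<longleftrightarrow>
          fits {1..n} (boxes (row_length \<mu>)) ?w (s B)" if "B \<in> F" for B
        unfolding diagram_eq_boxes by (rule fits_cong) (use t(2)[OF that] in auto)
      then have "Poly_Mapping.lookup (\<Sum>B\<in>F. polytabloid n \<mu> (t B)) T =
          (\<Sum>B\<in>F. of_bool (fits {1..n} (boxes (row_length \<mu>)) ?w (s B)) :: 'a)"
        unfolding lookup_sum t'(2) by (intro sum.cong) (simp_all add: lookup_polytabloid[OF char t(1) t'(1)])
      also have "\<dots> = of_nat (card {B\<in>F. fits {1..n} (boxes (row_length \<mu>)) ?w (s B)})"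
        using F by (simp add: sum.If_cases of_bool_def Int_def)
      also have "\<dots> = 0" using even[of ?w] by (simp add: of_nat_char_2[OF char])
      finally show ?thesis by simp
    next
      case False
      then show ?thesis by (simp add: lookup_sum lookup_polytabloid_eq_0[OF t(1)])
    qed
  qed
  moreover have "(\<Sum>B\<in>F. polytabloid n \<mu> (t B) - scale \<kappa> u) \<in> W"
    by (rule tabloid_space.subspace_sum[OF W(1)]) (rule poly[OF t(1)])
  moreover have "(\<Sum>B\<in>F. scale \<kappa> u) = scale (of_nat (card F) * \<kappa>) u"
    by (rule poly_mapping_eqI) (simp add: lookup_sum lookup_scale mult.assoc)
  ultimately have "- scale (of_nat (card F) * \<kappa>) u \<in> W" by (simp add: sum_subtractf)
  then have "scale (of_nat (card F) * \<kappa>) u \<in> W" using tabloid_space.subspace_neg[OF W(1)] by fastforce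
  moreover have "scale (of_nat (card F) * \<kappa>) u \<in> tabloid_space.span {u}"
    by (intro tabloid_space.span_scale tabloid_space.span_base) simp
  ultimately have "scale (of_nat (card F) * \<kappa>) u = 0" using W(2) by blast
  then have "of_nat (card F) * \<kappa> = 0" using u0 tabloid_space.scale_eq_0_iff by blast
  then show "even (card F)" using k by (simp add: of_nat_char_2[OF char])
qed

theorem theorem1p1:
  fixes n :: nat and \<mu> :: "nat list"
  assumes "CHAR('a::field) = 2"
    and "n \<ge> 1"
    and "is_partition n \<mu>"
    and "\<not> is_hook n \<mu>"
  shows "\<not> (\<exists>U :: (tabloid \<Rightarrow>\<^sub>0 'a) set.
           is_direct_summand n U (Specht n \<mu>) \<and> tabloid_space.dim U = 1)"
proof
  note char = assms(1)
  let ?T = "tableaux n \<mu>" and ?e = "\<lambda>t. polytabloid n \<mu> t :: tabloid \<Rightarrow>\<^sub>0 'a"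
  let ?R = "row_length \<mu>" and ?C = "column_length \<mu>"
  have part: "sorted_wrt (\<ge>) \<mu>" using assms(3) by (simp add: is_partition_def)
  have conj: "conjugate ?R ?C" by (rule conjugate_row_column_length[OF part])
  assume "\<exists>U :: (tabloid \<Rightarrow>\<^sub>0 'a) set. is_direct_summand n U (Specht n \<mu>) \<and> tabloid_space.dim U = 1"
  then obtain U W :: "(tabloid \<Rightarrow>\<^sub>0 'a) set" where U: "is_submodule n U" and W: "is_submodule n W"
    and UW: "U \<inter> W = {0}" and S: "Specht n \<mu> = {u + w |u w. u \<in> U \<and> w \<in> W}"
    and dim: "tabloid_space.dim U = 1"
    unfolding is_direct_summand_def by blast
  have subU: "tabloid_space.subspace U" and subW: "tabloid_space.subspace W"
    using U W by (auto simp: is_submodule_def)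
  obtain u where u: "U = tabloid_space.span {u}" "u \<noteq> 0"
  proof -
    obtain B where B: "B \<subseteq> U" "tabloid_space.independent B" "U \<subseteq> tabloid_space.span B" "card B = tabloid_space.dim U"
      using tabloid_space.basis_exists[of U] by blast
    obtain b where b: "B = {b}" using B(4) dim by (auto simp: card_1_singleton_iff)
    have "U = tabloid_space.span {b}"
      using B(1,3) b tabloid_space.span_minimal[OF _ subU] by blast
    moreover have "b \<noteq> 0" using B(2) b tabloid_space.dependent_zero by blast
    ultimately show thesis using that by blast
  qed
  have uU: "u \<in> U" unfolding u(1) by (rule tabloid_space.span_base) simp
  have "0 \<in> W" by (rule tabloid_space.subspace_0[OF subW])
  then have "u + 0 \<in> Specht n \<mu>" unfolding S using uU by blast
  then have "u \<in> Specht n \<mu>" by simp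
  then obtain c where c: "u = (\<Sum>e\<in>?e ` ?T. scale (c e) e)"
    unfolding Specht_def tabloid_space.span_finite[OF finite_imageI[OF finite_tableaux]] by blast
  have supp: "T \<in> tabloid_of n \<mu> ` ?T" if "Poly_Mapping.lookup u T \<noteq> 0" for T
  proof (rule ccontr)
    assume T: "T \<notin> tabloid_of n \<mu> ` ?T"
    have "Poly_Mapping.lookup u T = (\<Sum>e\<in>?e ` ?T. c e * Poly_Mapping.lookup e T)"
      unfolding c lookup_sum lookup_scale ..
    also have "\<dots> = 0" by (rule sum.neutral) (use lookup_polytabloid_eq_0[OF _ T] in auto)
    finally show False using that by simp
  qed
  obtain T0 where T0: "Poly_Mapping.lookup u T0 \<noteq> 0" using u(2) by (metis lookup_zero poly_mapping_eqI)
  then obtain t0 where t0: "t0 \<in> ?T" "T0 = tabloid_of n \<mu> t0" using supp by blast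
  define \<gamma> where "\<gamma> = Poly_Mapping.lookup u T0"
  \<comment> \<open>The symmetric group is transitive on tableaux and generated by transpositions,
    which fix \<open>u\<close>. So \<open>u\<close> is \<gamma> times the sum of all
    tabloids.\<close>
  have \<gamma>: "Poly_Mapping.lookup u (tabloid_of n \<mu> t) = \<gamma>" if t: "t \<in> ?T" for t
  proof -
    obtain \<pi> where p: "\<pi> permutes {1..n}" "t = \<pi> \<circ> t0" using exists_permutation[OF t0(1) t] by blast
    from p(1) have "Poly_Mapping.lookup u (tabloid_of n \<mu> (\<pi> \<circ> t0)) = \<gamma>"
      using finite_atLeastAtMost
    proof (induction rule: permutes_induct)
      case id
      then show ?case by (simp add: \<gamma>_def t0(2))
    next
      case (swap a b \<rho>)
      let ?t = "transpose a b"
      have tp: "?t permutes {1..n}" using swap by (intro permutes_swap_id)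
      have i: "inv ?t = ?t" by (rule inv_unique_comp; simp)
      have rt: "\<rho> \<circ> t0 \<in> ?T" by (rule permute_tableau[OF t0(1) swap(4)])
      have "Poly_Mapping.lookup u (tabloid_of n \<mu> (?t \<circ> (\<rho> \<circ> t0))) =
          Poly_Mapping.lookup (act ?t u) (tabloid_of n \<mu> (?t \<circ> (\<rho> \<circ> t0)))"
        using transpose_invariant_if_dim_1[OF char _ u(2), of n a b] U u(1) swap by simp
      also have "\<dots> = Poly_Mapping.lookup u (tabloid_of n \<mu> (?t \<circ> (?t \<circ> (\<rho> \<circ> t0))))"
        unfolding lookup_act[OF tp] i permute_tabloid[OF permute_tableau[OF rt tp] tp] ..
      also have "?t \<circ> (?t \<circ> (\<rho> \<circ> t0)) = \<rho> \<circ> t0" by (simp add: comp_assoc[symmetric])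
      finally show ?case using swap by (simp add: comp_assoc)
    qed
    then show ?thesis using p by simp
  qed
  have \<gamma>0: "\<gamma> \<noteq> 0" using T0 by (simp add: \<gamma>_def)
  \<comment> \<open>The combination is indexed by polytabloids, which several tableaux may share;
    one tableau is chosen for each.\<close>
  let ?s = "\<lambda>e. column_word \<mu> (inv_into ?T ?e e)"
  have inv: "inv_into ?T ?e e \<in> ?T" "?e (inv_into ?T ?e e) = e" if "e \<in> ?e ` ?T" for e
    using inv_into_into[OF that] f_inv_into_f[OF that] by simp_all
  have comb: "uniform_combination {1..n} ?R ?C (?e ` ?T) (\<lambda>e. c e / \<gamma>) ?s"
    unfolding uniform_combination_def
  proof (intro conjI ballI allI impI)
    show "finite (?e ` ?T)" by (rule finite_imageI[OF finite_tableaux])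
    show "has_content {1..n} (?s e) ?C" if "e \<in> ?e ` ?T" for e
      using content_col_fits[OF conj] fit_words[OF inv(1)[OF that]] by (simp add: diagram_eq_boxes)
    fix w assume w: "has_content {1..n} w ?R"
    \<comment> \<open>Sorting the rows supplies a column word, so \<open>w\<close> is the row word
      of some tableau.\<close>
    have "fits {1..n} (boxes ?C) (column_rank {1..n} w) w"
      by (rule fits_column_rank[OF conjugate_sym[OF conj] _ w]) simp
    then have "fits {1..n} (diagram \<mu>) w (column_rank {1..n} w)"
      by (simp add: fits_sym[OF conj] diagram_eq_boxes)
    then obtain t where t: "t \<in> ?T" "\<And>i. i \<in> {1..n} \<Longrightarrow> row_word \<mu> t i = w i"
      by (rule exists_tableau) blast
    have "Poly_Mapping.lookup e (tabloid_of n \<mu> t) = of_bool (fits {1..n} (boxes ?R) w (?s e))"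
      if e: "e \<in> ?e ` ?T" for e
    proof -
      have "Poly_Mapping.lookup (?e (inv_into ?T ?e e)) (tabloid_of n \<mu> t) =
          of_bool (fits {1..n} (diagram \<mu>) (row_word \<mu> t) (?s e))"
        by (rule lookup_polytabloid[OF char inv(1)[OF e] t(1)])
      moreover have "fits {1..n} (diagram \<mu>) (row_word \<mu> t) (?s e) \<longleftrightarrow> fits {1..n} (boxes ?R) w (?s e)"
        unfolding diagram_eq_boxes by (rule fits_cong) (use t(2) in auto)
      ultimately show ?thesis unfolding inv(2)[OF e] by simp
    qed
    then have sum: "(\<Sum>e\<in>?e ` ?T. c e * of_bool (fits {1..n} (boxes ?R) w (?s e))) = \<gamma>"
      using \<gamma>[OF t(1)] unfolding c lookup_sum lookup_scale by (metis (no_types, lifting) sum.cong)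
    have "(\<Sum>e\<in>?e ` ?T. c e / \<gamma> * of_bool (fits {1..n} (boxes ?R) w (?s e))) =
        (\<Sum>e\<in>?e ` ?T. c e * of_bool (fits {1..n} (boxes ?R) w (?s e))) / \<gamma>"
      by (simp add: sum_divide_distrib)
    then show "(\<Sum>e\<in>?e ` ?T. c e / \<gamma> * of_bool (fits {1..n} (boxes ?R) w (?s e))) = 1"
      unfolding sum using \<gamma>0 by simp
  qed
  \<comment> \<open>The projection onto \<open>U\<close> along \<open>W\<close>, written as a
    multiple of \<open>u\<close>, is well defined.\<close>
  have unique: "\<alpha> = \<beta>" if "v - scale \<alpha> u \<in> W" "v - scale \<beta> u \<in> W" for v \<alpha> \<beta>
  proof -
    have "(v - scale \<beta> u) - (v - scale \<alpha> u) \<in> W" by (rule tabloid_space.subspace_diff[OF subW that(2,1)])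
    moreover have "(v - scale \<beta> u) - (v - scale \<alpha> u) = scale (\<alpha> - \<beta>) u"
      by (simp add: tabloid_space.scale_left_diff_distrib)
    moreover have "scale (\<alpha> - \<beta>) u \<in> U" using uU subU by (simp add: tabloid_space.subspace_scale)
    ultimately have "scale (\<alpha> - \<beta>) u = 0" using UW by (metis IntI singletonD)
    then show ?thesis using u(2) tabloid_space.scale_eq_0_iff by fastforce
  qed
  have proj: "\<exists>\<alpha>. ?e t - scale \<alpha> u \<in> W" if t: "t \<in> ?T" for t
  proof -
    have "?e t \<in> Specht n \<mu>" unfolding Specht_def by (rule tabloid_space.span_base) (use t in blast)
    then obtain v w where v: "?e t = v + w" "v \<in> U" "w \<in> W" unfolding S by blast
    then obtain \<alpha> where "v = scale \<alpha> u" unfolding u(1) by (auto simp: tabloid_space.span_singleton)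
    then have "?e t - scale \<alpha> u = w" using v(1) by simp
    then show ?thesis using v(3) by blast
  qed
  then obtain \<kappa> where k0: "?e t0 - scale \<kappa> u \<in> W" using t0(1) by blast
  have act_u: "act \<pi> u = u" if p: "\<pi> permutes {1..n}" for \<pi>
  proof (rule poly_mapping_eqI)
    fix T :: tabloid
    have i: "(\<lambda>t. \<pi> \<circ> t) ` (\<lambda>t. inv \<pi> \<circ> t) ` T = T"
      using permutes_inverses[OF p] by (simp add: image_image comp_assoc[symmetric] comp_def)
    show "Poly_Mapping.lookup (act \<pi> u) T = Poly_Mapping.lookup u T"
    proof (cases "T \<in> tabloid_of n \<mu> ` ?T")
      case True
      then obtain t where t: "t \<in> ?T" "T = tabloid_of n \<mu> t" by blast
      show ?thesis
        unfolding lookup_act[OF p] t(2) permute_tabloid[OF t(1) permutes_inv[OF p]]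
          \<gamma>[OF t(1)] \<gamma>[OF permute_tableau[OF t(1) permutes_inv[OF p]]] ..
    next
      case False
      have "(\<lambda>t. inv \<pi> \<circ> t) ` T \<notin> tabloid_of n \<mu> ` ?T"
      proof
        assume "(\<lambda>t. inv \<pi> \<circ> t) ` T \<in> tabloid_of n \<mu> ` ?T"
        then obtain t where t: "t \<in> ?T" "(\<lambda>t. inv \<pi> \<circ> t) ` T = tabloid_of n \<mu> t" by blast
        then have "T = tabloid_of n \<mu> (\<pi> \<circ> t)" using permute_tabloid[OF t(1) p] i by simp
        then show False using False permute_tableau[OF t(1) p] by blast
      qed
      then show ?thesis using supp False unfolding lookup_act[OF p] by metis
    qed
  qed
  \<comment> \<open>Permutations carry one polytabloid to any other, fix \<open>u\<close> and
    preserve \<open>W\<close>, so all polytabloids have the same projection.\<close>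
  have k: "?e t - scale \<kappa> u \<in> W" if t: "t \<in> ?T" for t
  proof -
    obtain \<pi> where p: "\<pi> permutes {1..n}" "t = \<pi> \<circ> t0" using exists_permutation[OF t0(1) t] by blast
    have "act \<pi> (?e t0 - scale \<kappa> u) = act \<pi> (?e t0) - scale \<kappa> (act \<pi> u)"
      by (rule poly_mapping_eqI) (simp add: lookup_act[OF p(1)] lookup_minus lookup_scale)
    also have "\<dots> = ?e t - scale \<kappa> u" unfolding act_u[OF p(1)] act_polytabloid[OF char t0(1) p(1)] p(2) ..
    finally show ?thesis using W k0 p(1) by (metis is_submodule_def)
  qed
  \<comment> \<open>Projecting the expression of \<open>u\<close> in polytabloids shows that its
    coefficients have a nonzero sum, whereas for a shape that is not a hook the sum is 0.\<close>
  have "\<kappa> * (\<Sum>e\<in>?e ` ?T. c e) = 1"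
  proof (rule unique)
    have "(\<Sum>e\<in>?e ` ?T. scale (c e) (e - scale \<kappa> u)) \<in> W"
      by (intro tabloid_space.subspace_sum[OF subW] tabloid_space.subspace_scale[OF subW]) (use k in blast)
    moreover have "(\<Sum>e\<in>?e ` ?T. scale (c e) (e - scale \<kappa> u)) = u - scale (\<kappa> * (\<Sum>e\<in>?e ` ?T. c e)) u"
    proof -
      have "(\<Sum>e\<in>?e ` ?T. scale (c e) (e - scale \<kappa> u)) =
          (\<Sum>e\<in>?e ` ?T. scale (c e) e) - (\<Sum>e\<in>?e ` ?T. scale (c e) (scale \<kappa> u))"
        by (simp add: tabloid_space.scale_right_diff_distrib sum_subtractf)
      also have "(\<Sum>e\<in>?e ` ?T. scale (c e) (scale \<kappa> u)) = scale (\<kappa> * (\<Sum>e\<in>?e ` ?T. c e)) u"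
        by (simp add: tabloid_space.scale_sum_left[symmetric] sum_distrib_left mult.commute)
      finally show ?thesis using c by simp
    qed
    ultimately show "u - scale (\<kappa> * (\<Sum>e\<in>?e ` ?T. c e)) u \<in> W" by simp
    show "u - scale 1 u \<in> W" using \<open>0 \<in> W\<close> by simp
  qed
  moreover from this have "\<kappa> \<noteq> 0" by auto
  then have g: "garnir ?C"
    using column_words_garnir[OF char part t0(1) u(2) subW _ _ k] UW u(1) by blast
  have "(\<Sum>e\<in>?e ` ?T. c e / \<gamma>) = 0"
  proof (rule sum_uniform_combination_nonhook[OF char conj _ comb _ g])
    show "has_content {1..n} (row_word \<mu> t0) ?R"
      using content_row_fits fit_words[OF t0(1)] by (simp add: diagram_eq_boxes)
    show "2 \<le> ?R 1" by (rule two_le_row_length_1[OF assms(3,4,2)])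
  qed simp
  then have "(\<Sum>e\<in>?e ` ?T. c e) = 0" using \<gamma>0 by (simp add: sum_divide_distrib[symmetric])
  ultimately show False by simp
qed

end
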